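(* Let $1\le p\le\infty$, let $\Omega\subseteq\mathbb{R}^N$ be an open set and let $x\in\Omega$. If $u\in C^2(\Omega)$ with $\nabla u(x)\ne0$, then $$\mu_p(\varepsilon,u)(x)=u(x)+\frac12\,\frac{\Delta_p^nu(x)}{N+p}\,\varepsilon^2+o(\varepsilon^2)\quad\text{as }\varepsilon\to0.$$
   Context: $B_\varepsilon(x)$ is the open Euclidean ball of radius $\varepsilon$ centered at $x$. For $1\le p\le\infty$ and $u$ continuous on $\overline{B_\varepsilon(x)}$, $\mu_p(\varepsilon,u)(x)$ is the unique real number $\mu$ such that $\|u-\mu\|_{L^p(B_\varepsilon(x))}=\min_{\lambda\in\mathbb{R}}\|u-\lambda\|_{L^p(B_\varepsilon(x))}$ (Lebesgue measure). Where $\nabla u\neq0$, the normalized $p$-Laplacian is $$\Delta_p^nu=\frac{\nabla\cdot(|\nabla u|^{p-2}\nabla u)}{|\nabla u|^{p-2}}=\Delta u+(p-2)\frac{\langle\nabla^2u\,\nabla u,\nabla u\rangle}{|\nabla u|^2}\quad(1\le p<\infty),\qquad \Delta_\infty^nu=\frac{\langle\nabla^2u\,\nabla u,\nabla u\rangle}{|\nabla u|^2}.$$ For $p=\infty$, the quotient $\frac{\Delta_p^nu(x)}{N+p}$ is understood as its limit as $p\to\infty$, i.e. $\Delta_\infty^nu(x)$. *)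

theory Defs
  imports
    "HOL-Analysis.Analysis"
    "HOL-Library.Landau_Symbols"
    "HOL-Probability.Essential_Supremum"
begin

definition grad :: "('a::euclidean_space \<Rightarrow> real) \<Rightarrow> 'a \<Rightarrow> 'a" where
  "grad u x = (\<Sum>b\<in>Basis. frechet_derivative u (at x) b *\<^sub>R b)"

definition divergence :: "('a::euclidean_space \<Rightarrow> 'a) \<Rightarrow> 'a \<Rightarrow> real" where
  "divergence F x = (\<Sum>b\<in>Basis. frechet_derivative F (at x) b \<bullet> b)"

definition laplacian :: "('a::euclidean_space \<Rightarrow> real) \<Rightarrow> 'a \<Rightarrow> real" where
  "laplacian u = divergence (grad u)"

definition hessian :: "('a::euclidean_space \<Rightarrow> real) \<Rightarrow> 'a \<Rightarrow> 'a \<Rightarrow> 'a" where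
  "hessian u x = frechet_derivative (grad u) (at x)"

(* For open S. In finite dimension, continuity of each y \<mapsto> hessian u y v is the same as
   continuity of the second derivative as a map into the bounded linear operators. *)
definition C2_on :: "'a::euclidean_space set \<Rightarrow> ('a \<Rightarrow> real) \<Rightarrow> bool" where
  "C2_on S u \<longleftrightarrow>
     (\<forall>y\<in>S. u differentiable (at y)) \<and>
     (\<forall>y\<in>S. grad u differentiable (at y)) \<and>
     (\<forall>v. continuous_on S (\<lambda>y. hessian u y v))"

(* Defined for all points, but meaningful only where the gradient does not vanish.
   The expanded form for p < \<infinity> is normalized_p_laplacian_expand below. *)
definition normalized_p_laplacian :: "ereal \<Rightarrow> ('a::euclidean_space \<Rightarrow> real) \<Rightarrow> 'a \<Rightarrow> real" where
  "normalized_p_laplacian p u x =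
     (if p = \<infinity> then (hessian u x (grad u x) \<bullet> grad u x) / (norm (grad u x))\<^sup>2
      else let q = real_of_ereal p - 2 in
        divergence (\<lambda>y. norm (grad u y) powr q *\<^sub>R grad u y) x / norm (grad u x) powr q)"

(* The quotient of the normalized p-Laplacian by N + p; its value at p = \<infinity> is the limit as
   p tends to infinity, see p_laplacian_quotient_tendsto below. *)
definition p_laplacian_quotient :: "ereal \<Rightarrow> ('a::euclidean_space \<Rightarrow> real) \<Rightarrow> 'a \<Rightarrow> real" where
  "p_laplacian_quotient p u x =
     (if p = \<infinity> then normalized_p_laplacian \<infinity> u x
      else normalized_p_laplacian p u x / (real DIM('a) + real_of_ereal p))"

(* Real-valued, hence the actual L^p norm only for functions in L^p (a value that would be
   infinite is returned as 0); it is applied below to bounded continuous functions on balls. *)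
definition Lp_norm :: "ereal \<Rightarrow> 'a measure \<Rightarrow> ('a \<Rightarrow> real) \<Rightarrow> real" where
  "Lp_norm p M f =
     (if p = \<infinity> then real_of_ereal (esssup M (\<lambda>y. ereal \<bar>f y\<bar>))
      else (LINT y|M. \<bar>f y\<bar> powr real_of_ereal p) powr (1 / real_of_ereal p))"

definition mu_p :: "ereal \<Rightarrow> real \<Rightarrow> ('a::euclidean_space \<Rightarrow> real) \<Rightarrow> 'a \<Rightarrow> real" where
  "mu_p p \<epsilon> u x =
     (THE m. \<forall>l. Lp_norm p (lebesgue_on (ball x \<epsilon>)) (\<lambda>y. u y - m)
               \<le> Lp_norm p (lebesgue_on (ball x \<epsilon>)) (\<lambda>y. u y - l))"

lemma GDERIV_grad:
  assumes "u differentiable (at x)"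
  shows "GDERIV u x :> grad u x"
proof -
  let ?D = "frechet_derivative u (at x)"
  have D: "(u has_derivative ?D) (at x)"
    using assms frechet_derivative_works by blast
  then have lin: "linear ?D"
    using has_derivative_linear by blast
  have "?D h = h \<bullet> grad u x" for h
  proof -
    have "?D h = ?D (\<Sum>b\<in>Basis. (h \<bullet> b) *\<^sub>R b)"
      by (simp add: euclidean_representation)
    also have "\<dots> = (\<Sum>b\<in>Basis. (h \<bullet> b) * ?D b)"
      by (simp add: linear_sum[OF lin] linear_scale[OF lin])
    also have "\<dots> = h \<bullet> grad u x"
      by (simp add: grad_def inner_sum_right mult.commute)
    finally show ?thesis .
  qed
  then have "?D = (\<lambda>h. h \<bullet> grad u x)"
    by blast
  with D show ?thesis
    unfolding gderiv_def by simp
qed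

lemma normalized_p_laplacian_expand:
  fixes u :: "'a::euclidean_space \<Rightarrow> real" and p :: real
  assumes diff: "grad u differentiable (at x)" and nz: "grad u x \<noteq> 0"
  shows "normalized_p_laplacian (ereal p) u x =
           laplacian u x + (p - 2) * (hessian u x (grad u x) \<bullet> grad u x) / (norm (grad u x))\<^sup>2"
proof -
  define G where "G = grad u x"
  define H where "H = hessian u x"
  define q where "q = p - 2"
  define n where "n = norm G"
  have n: "n > 0" using nz by (simp add: n_def G_def)
  have H: "(grad u has_derivative H) (at x)"
    using diff frechet_derivative_works unfolding H_def hessian_def by blast
  have lin: "linear H" using H has_derivative_linear by blast
  have 1: "((\<lambda>y. norm (grad u y)) has_derivative (\<lambda>h. H h \<bullet> sgn G)) (at x)"
    using has_derivative_compose[OF H has_derivative_norm[OF nz]] by (simp add: G_def inner_commute)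
  have 2: "((\<lambda>y. norm (grad u y) powr q) has_derivative (\<lambda>h. n powr q * (H h \<bullet> sgn G * q / n))) (at x)"
    using has_derivative_powr[OF 1 has_derivative_const[of q]] n
    by (simp add: n_def G_def)
  have 3: "((\<lambda>y. norm (grad u y) powr q *\<^sub>R grad u y) has_derivative
      (\<lambda>h. n powr q *\<^sub>R H h + (n powr q * (H h \<bullet> sgn G * q / n)) *\<^sub>R G)) (at x)"
    using has_derivative_scaleR[OF 2 H] by (simp add: n_def G_def)
  have "divergence (\<lambda>y. norm (grad u y) powr q *\<^sub>R grad u y) x
      = (\<Sum>b\<in>Basis. (n powr q *\<^sub>R H b + (n powr q * (H b \<bullet> sgn G * q / n)) *\<^sub>R G) \<bullet> b)"
    unfolding divergence_def frechet_derivative_at[OF 3, symmetric] ..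
  also have "\<dots> = n powr q * ((\<Sum>b\<in>Basis. H b \<bullet> b) + q / n\<^sup>2 * (\<Sum>b\<in>Basis. (H b \<bullet> G) * (G \<bullet> b)))"
    using n by (simp add: sum.distrib sum_distrib_left inner_add_left sgn_div_norm distrib_left
        flip: n_def) (simp add: field_simps power2_eq_square)
  also have "(\<Sum>b\<in>Basis. (H b \<bullet> G) * (G \<bullet> b)) = H (\<Sum>b\<in>Basis. (G \<bullet> b) *\<^sub>R b) \<bullet> G"
    by (simp add: linear_sum[OF lin] linear_scale[OF lin] inner_sum_left mult.commute)
  also have "\<dots> = H G \<bullet> G"
    by (simp add: euclidean_representation)
  also have "(\<Sum>b\<in>Basis. H b \<bullet> b) = laplacian u x"
    by (simp add: laplacian_def divergence_def H_def hessian_def)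
  finally show ?thesis
    using n by (simp add: normalized_p_laplacian_def q_def n_def G_def H_def)
qed

lemma p_laplacian_quotient_tendsto:
  fixes u :: "'a::euclidean_space \<Rightarrow> real"
  assumes diff: "grad u differentiable (at x)" and nz: "grad u x \<noteq> 0"
  shows "((\<lambda>p. p_laplacian_quotient (ereal p) u x) \<longlongrightarrow> p_laplacian_quotient \<infinity> u x) at_top"
proof -
  define c where "c = (hessian u x (grad u x) \<bullet> grad u x) / (norm (grad u x))\<^sup>2"
  define a where "a = laplacian u x"
  define N where "N = real DIM('a)"
  have t: "filterlim (\<lambda>p::real. N + p) at_top at_top"
    by (intro filterlim_tendsto_add_at_top[OF tendsto_const] filterlim_ident)
  have "((\<lambda>p. c + (a - (N + 2) * c) / (N + p)) \<longlongrightarrow> c + 0) at_top"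
    by (intro tendsto_add tendsto_const tendsto_divide_0[OF tendsto_const]
        filterlim_at_top_imp_at_infinity t)
  moreover have "\<forall>\<^sub>F p in at_top. c + (a - (N + 2) * c) / (N + p) = p_laplacian_quotient (ereal p) u x"
    using eventually_gt_at_top[of 0]
  proof eventually_elim
    case (elim p)
    have "N + p > 0" using elim by (simp add: N_def add_nonneg_pos)
    moreover have "p_laplacian_quotient (ereal p) u x = (a + (p - 2) * c) / (N + p)"
      by (simp add: p_laplacian_quotient_def normalized_p_laplacian_expand[OF assms] a_def c_def N_def)
    ultimately show ?case by (simp add: field_simps)
  qed
  ultimately show ?thesis
    by (simp add: p_laplacian_quotient_def[of \<infinity>] normalized_p_laplacian_def c_def tendsto_cong)
qed

end

theory Submission
  imports Defs
begin

text \<open>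
  Let \<open>p = q + 1 < \<infinity>\<close>, \<open>g s = sgn s * |s|^q\<close> and \<open>\<xi> = \<nabla>u(x)\<close>. The minimizer lies between \<open>l1\<close> and \<open>l2\<close> as soon as
  the integral of \<open>g (u - l)\<close> over the ball is positive at \<open>l = l1\<close> and negative at \<open>l = l2\<close>, so it is
  enough to find the limit of the integral of \<open>g f\<close> over the unit ball, divided by \<open>\<epsilon>\<close>, where
  \<open>f z = (u (x + \<epsilon> z) - u x) / \<epsilon> - \<epsilon> k = a z + \<epsilon> w z\<close> with \<open>a z = \<langle>\<xi>, z\<rangle>\<close>. Differentiating \<open>g\<close> would produce the
  singular weight \<open>|a|^(p-2)\<close> (a surface measure if \<open>p = 1\<close>). This is avoided with the vector field
  \<open>Y z = \<xi> - a z z\<close>, which is tangent to the unit sphere: since \<open>|\<xi>|^2 = \<langle>Y, \<nabla>f\<rangle> + a^2 - \<epsilon> \<langle>Y, \<nabla>w\<rangle>\<close> and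
  \<open>a = f - \<epsilon> w\<close>, integrating \<open>g f \<langle>Y, \<nabla>f\<rangle> = \<langle>Y, \<nabla>(|f|^p / p)\<rangle>\<close> by parts leaves only bounded integrands, for
  every \<open>p \<ge> 1\<close>. The limit is then evaluated on quadratic \<open>w\<close> by further integrations by parts, all of
  which rest on translation invariance of Lebesgue measure.

  For \<open>p = \<infinity>\<close> the minimizer is the midpoint of the minimum and the maximum of \<open>u\<close>, which are attained
  near \<open>x - \<epsilon> \<xi> / |\<xi>|\<close> and \<open>x + \<epsilon> \<xi> / |\<xi>|\<close>.
\<close>

section \<open>Integration by parts on the unit ball\<close>

text \<open>After the integration by parts, the main term is a multiple of the integral of |f|^p a,
  which is of order 1 and cannot yet be divided by \<epsilon>. The integral of |a|^p a vanishes by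
  oddness, so only (|f|^p - |a|^p) / \<epsilon> matters, and convexity of |s|^p squeezes this
  quotient between p g(a) w and p g(f) w. The squeeze uses continuity of g only off the null set a =
  0, so the jump of g at p = 1 is harmless. Integrating by parts does require |s|^p to be
  differentiable, so the identities are shown for q > 0 and carried to q = 0 along q = 1/(n+1).

  The resulting limit is affine and strictly decreasing in k, with its zero at the claimed
  coefficient c. Only its sign is used: at k = c - \<delta> and k = c + \<delta> the signs are
  opposite, which traps the minimizer up to \<delta> times the square of \<epsilon>. Since
  \<open>mu_p\<close> is a definite description, existence and uniqueness of the minimizer have to
  be proved as well.\<close>

abbreviation unit_ball_measure :: "'a::euclidean_space measure" where
  "unit_ball_measure \<equiv> lebesgue_on (ball 0 1)"

lemma lebesgue_integral_affine:
  fixes f :: "'a::euclidean_space \<Rightarrow> real"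
  assumes f: "f \<in> borel_measurable lebesgue" and c: "c \<noteq> 0"
  shows "integral\<^sup>L lebesgue f = \<bar>c\<bar> ^ DIM('a) * integral\<^sup>L lebesgue (\<lambda>z. f (t + c *\<^sub>R z))"
    and "(\<lambda>z. f (t + c *\<^sub>R z)) \<in> borel_measurable lebesgue"
proof -
  have T: "t + (\<Sum>j\<in>Basis. (c * (x \<bullet> j)) *\<^sub>R j) = t + c *\<^sub>R x" for x
    unfolding scaleR_scaleR[symmetric] scaleR_sum_right[symmetric] euclidean_representation ..
  have m: "(\<lambda>x. t + c *\<^sub>R x) \<in> lebesgue \<rightarrow>\<^sub>M lebesgue"
    and eq: "(lebesgue :: 'a measure) =
      density (distr lebesgue lebesgue (\<lambda>x. t + c *\<^sub>R x)) (\<lambda>_. ennreal (\<bar>c\<bar> ^ DIM('a)))"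
    using lebesgue_affine_euclidean[of "\<lambda>_. c" t] lebesgue_affine_measurable[of "\<lambda>_. c" t] c
    unfolding T by (simp_all add: prod_constant)
  show "(\<lambda>z. f (t + c *\<^sub>R z)) \<in> borel_measurable lebesgue"
    using measurable_compose[OF m f] .
  have "integral\<^sup>L lebesgue f =
      integral\<^sup>L (density (distr lebesgue lebesgue (\<lambda>x. t + c *\<^sub>R x)) (\<lambda>_. ennreal (\<bar>c\<bar> ^ DIM('a)))) f"
    using eq by simp
  also have "\<dots> = \<bar>c\<bar> ^ DIM('a) * integral\<^sup>L lebesgue (\<lambda>z. f (t + c *\<^sub>R z))"
    using f m by (subst integral_density) (auto simp: integral_distr)
  finally show "integral\<^sup>L lebesgue f = \<bar>c\<bar> ^ DIM('a) * integral\<^sup>L lebesgue (\<lambda>z. f (t + c *\<^sub>R z))" .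
qed

lemma integral_lebesgue_on_ball_rescale:
  fixes f :: "'a::euclidean_space \<Rightarrow> real"
  assumes f: "f \<in> borel_measurable (lebesgue_on (ball x e))" and e: "e > 0"
  shows "integral\<^sup>L (lebesgue_on (ball x e)) f =
    e ^ DIM('a) * integral\<^sup>L unit_ball_measure (\<lambda>z. f (x + e *\<^sub>R z))"
proof -
  let ?F = "\<lambda>y. indicator (ball x e) y *\<^sub>R f y"
  have F: "?F \<in> borel_measurable lebesgue"
    using f borel_measurable_restrict_space_iff[of "ball x e" lebesgue f] by simp
  have ind: "indicator (ball x e) (x + e *\<^sub>R z) = (indicator (ball 0 1) z :: real)" for z
    using e by (auto simp: indicator_def dist_norm)
  have "integral\<^sup>L (lebesgue_on (ball x e)) f = integral\<^sup>L lebesgue ?F"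
    by (intro integral_restrict_space) auto
  also have "\<dots> = e ^ DIM('a) * integral\<^sup>L lebesgue (\<lambda>z. ?F (x + e *\<^sub>R z))"
    using lebesgue_integral_affine(1)[OF F, of e x] e by simp
  also have "integral\<^sup>L lebesgue (\<lambda>z. ?F (x + e *\<^sub>R z)) =
      integral\<^sup>L unit_ball_measure (\<lambda>z. f (x + e *\<^sub>R z))"
    unfolding ind by (intro integral_restrict_space[symmetric]) auto
  finally show ?thesis .
qed

text \<open>The reflection of the ball is the affine map with factor -1. This removes the term of
  order 1 that would otherwise spoil the division by \<epsilon>.\<close>

lemma integral_unit_ball_odd:
  fixes f :: "'a::euclidean_space \<Rightarrow> real"
  assumes f: "f \<in> borel_measurable unit_ball_measure" and odd: "\<And>z. f (- z) = - f z"
  shows "integral\<^sup>L unit_ball_measure f = 0"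
proof -
  let ?F = "\<lambda>y. indicator (ball 0 1) y *\<^sub>R f y"
  have F: "?F \<in> borel_measurable lebesgue"
    using f borel_measurable_restrict_space_iff[of "ball 0 1" lebesgue f] by simp
  have "?F (0 + (- 1) *\<^sub>R z) = - ?F z" for z
    by (simp add: odd indicator_def)
  then have "integral\<^sup>L lebesgue ?F = - integral\<^sup>L lebesgue ?F"
    using lebesgue_integral_affine(1)[OF F, of "- 1" 0] by simp
  then show ?thesis
    by (subst integral_restrict_space) auto
qed

lemma finite_measure_lebesgue_on_ball:
  "finite_measure (lebesgue_on (ball (x::'a::euclidean_space) e))"
  by (intro finite_measure_lebesgue_on lmeasurable_ball)

lemma integrable_ball_bounded:
  fixes f :: "'a::euclidean_space \<Rightarrow> real"
  assumes "f \<in> borel_measurable (lebesgue_on (ball x e))" and "\<And>z. z \<in> ball x e \<Longrightarrow> \<bar>f z\<bar> \<le> C"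
  shows "integrable (lebesgue_on (ball x e)) f"
proof (rule finite_measure.integrable_const_bound[OF finite_measure_lebesgue_on_ball])
  show "AE z in lebesgue_on (ball x e). norm (f z) \<le> C"
    by (rule AE_I2) (use assms in \<open>simp add: space_restrict_space\<close>)
qed (rule assms)

lemma measurable_ball_continuous:
  fixes f :: "'a::euclidean_space \<Rightarrow> real"
  assumes "continuous_on (cball x e) f"
  shows "f \<in> borel_measurable (lebesgue_on (ball x e))"
  using assms by (intro continuous_imp_measurable_on_sets_lebesgue)
    (auto intro: continuous_on_subset[OF _ ball_subset_cball])

lemma bounded_cball_continuous:
  fixes f :: "'a::euclidean_space \<Rightarrow> 'b::real_normed_vector"
  assumes "continuous_on (cball x e) f"
  obtains C where "C > 0" "\<And>z. z \<in> cball x e \<Longrightarrow> norm (f z) \<le> C"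
  using compact_imp_bounded[OF compact_continuous_image[OF assms compact_cball]]
  by (auto simp: bounded_pos)

lemma integrable_ball_continuous:
  fixes f :: "'a::euclidean_space \<Rightarrow> real"
  assumes "continuous_on (cball x e) f"
  shows "integrable (lebesgue_on (ball x e)) f"
proof -
  obtain C where "\<And>z. z \<in> cball x e \<Longrightarrow> norm (f z) \<le> C"
    using bounded_cball_continuous[OF assms] by blast
  then show ?thesis
    by (intro integrable_ball_bounded[where C=C] measurable_ball_continuous assms) auto
qed

text \<open>Only the derivative in direction \<open>v\<close> is needed: the difference quotients of \<open>\<phi>\<close> have integral
  zero by translation invariance, and they are bounded because \<open>\<phi>\<close> decays linearly at the sphere.\<close>

lemma integral_directional_derivative_eq_0:
  fixes \<phi> D :: "'a::euclidean_space \<Rightarrow> real"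
  assumes meas: "\<phi> \<in> borel_measurable lebesgue" and measD: "D \<in> borel_measurable unit_ball_measure"
    and out: "\<And>z. z \<notin> ball 0 1 \<Longrightarrow> \<phi> z = 0"
    and der: "\<And>z. z \<in> ball 0 1 \<Longrightarrow> ((\<lambda>t. \<phi> (z + t *\<^sub>R v)) has_real_derivative D z) (at 0)"
    and bD: "\<And>z. z \<in> ball 0 1 \<Longrightarrow> \<bar>D z\<bar> \<le> L"
    and decay: "\<And>z. z \<in> ball 0 1 \<Longrightarrow> \<bar>\<phi> z\<bar> \<le> L * (1 - norm z)"
  shows "integral\<^sup>L unit_ball_measure D = 0"
proof -
  have L: "L \<ge> 0" using bD[of 0] by simp
  \<comment> \<open>Two Lipschitz bounds are merged: L from the mean value inequality inside the
    ball (\<open>D\<close> is already the derivative along \<open>v\<close>), and L |v| when the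
    segment crosses the sphere.\<close>
  define L' where "L' = L * (1 + norm v)"
  have L': "L \<le> L'" "L * norm v \<le> L'" "L' \<ge> 0" using L by (auto simp: L'_def algebra_simps)
  have bnd: "\<bar>\<phi> (z + t *\<^sub>R v) - \<phi> z\<bar> \<le> L' * \<bar>t\<bar>" for z t
  proof -
    \<comment> \<open>If \<open>a\<close> is inside and \<open>b\<close> outside, the distance from
      \<open>a\<close> to the sphere is at most |b - a|, so the linear decay bounds the whole
      jump.\<close>
    have half: "\<bar>\<phi> a\<bar> \<le> L' * \<bar>t\<bar>" if "a \<in> ball 0 1" "b \<notin> ball 0 1" "norm (b - a) \<le> \<bar>t\<bar> * norm v" for a b
    proof -
      have "\<bar>\<phi> a\<bar> \<le> L * (1 - norm a)" by (rule decay) fact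
      also have "\<dots> \<le> L * (\<bar>t\<bar> * norm v)"
      proof (rule mult_left_mono[OF _ L])
        have "1 - norm a \<le> norm b - norm a" using that by simp
        also have "\<dots> \<le> \<bar>t\<bar> * norm v" using norm_triangle_ineq2[of b a] that by linarith
        finally show "1 - norm a \<le> \<bar>t\<bar> * norm v" .
      qed
      also have "\<dots> = (L * norm v) * \<bar>t\<bar>" by simp
      also have "\<dots> \<le> L' * \<bar>t\<bar>" using L' by (intro mult_right_mono) auto
      finally show ?thesis .
    qed
    consider "z \<in> ball 0 1" "z + t *\<^sub>R v \<in> ball 0 1" | "z \<in> ball 0 1" "z + t *\<^sub>R v \<notin> ball 0 1"
      | "z \<notin> ball 0 1" "z + t *\<^sub>R v \<in> ball 0 1" | "z \<notin> ball 0 1" "z + t *\<^sub>R v \<notin> ball 0 1" by blast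
    then show ?thesis
    proof cases
      case 1
      have d: "((\<lambda>s. \<phi> (z + s *\<^sub>R v)) has_real_derivative D (z + s *\<^sub>R v)) (at s within closed_segment 0 t)"
        and b: "\<bar>D (z + s *\<^sub>R v)\<bar> \<le> L"
        if "s \<in> closed_segment 0 t" for s
      proof -
        obtain r where r: "0 \<le> r" "r \<le> 1" "s = (1 - r) *\<^sub>R 0 + r *\<^sub>R t"
          using \<open>s \<in> closed_segment 0 t\<close> unfolding in_segment by blast
        have "(1 - r) *\<^sub>R z + r *\<^sub>R (z + t *\<^sub>R v) \<in> ball 0 1"
          using 1 r convexD_alt[OF convex_ball] by blast
        then have in': "z + s *\<^sub>R v \<in> ball 0 1"
          by (simp add: r algebra_simps)
        have "((\<lambda>h. \<phi> (z + s *\<^sub>R v + h *\<^sub>R v)) has_real_derivative D (z + s *\<^sub>R v)) (at 0)"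
          by (rule der[OF in'])
        then have "((\<lambda>h. \<phi> (z + (h + s) *\<^sub>R v)) has_real_derivative D (z + s *\<^sub>R v)) (at 0)"
          by (simp add: algebra_simps)
        then have "((\<lambda>s. \<phi> (z + s *\<^sub>R v)) has_real_derivative D (z + s *\<^sub>R v)) (at s)"
          using DERIV_shift[of "\<lambda>s. \<phi> (z + s *\<^sub>R v)" _ 0 s] by simp
        then show "((\<lambda>s. \<phi> (z + s *\<^sub>R v)) has_real_derivative D (z + s *\<^sub>R v)) (at s within closed_segment 0 t)"
          by (rule has_field_derivative_at_within)
        show "\<bar>D (z + s *\<^sub>R v)\<bar> \<le> L" by (rule bD[OF in'])
      qed
      have "norm (\<phi> (z + t *\<^sub>R v) - \<phi> (z + 0 *\<^sub>R v)) \<le> L * norm (t - 0)"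
        by (rule field_differentiable_bound[of "closed_segment 0 t" _ "\<lambda>s. D (z + s *\<^sub>R v)"])
          (use d b in auto)
      also have "\<dots> \<le> L' * \<bar>t\<bar>" using L' by (auto intro: mult_right_mono)
      finally show ?thesis by simp
    next
      case 2
      then show ?thesis using half[of z "z + t *\<^sub>R v"] out by auto
    next
      case 3
      then show ?thesis using half[of "z + t *\<^sub>R v" z] out by auto
    next
      case 4
      then show ?thesis using out L' by auto
    qed
  qed
  \<comment> \<open>Difference quotients with step 1/(n+1): each has integral zero by translation
    invariance, and they converge to \<open>D\<close> in the ball and to 0 outside its
    closure.\<close>
  define s where "s n z = (\<phi> (z + (1 / real (Suc n)) *\<^sub>R v) - \<phi> z) * real (Suc n)" for n z
  have sh: "(\<lambda>z. \<phi> (z + h *\<^sub>R v)) \<in> borel_measurable lebesgue"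
    "integral\<^sup>L lebesgue (\<lambda>z. \<phi> (z + h *\<^sub>R v)) = integral\<^sup>L lebesgue \<phi>" for h
    using lebesgue_integral_affine[OF meas, of 1 "h *\<^sub>R v"] by (simp_all add: add.commute)
  have zero: "norm ((1 / real (Suc n)) *\<^sub>R v) \<le> norm v" for n
    using mult_right_mono[of "1 / real (Suc n)" 1 "norm v"] by simp
  have bphi: "\<bar>\<phi> z\<bar> \<le> L * indicator (cball 0 1) z" for z
  proof (cases "z \<in> ball 0 1")
    case True
    then have "L * (1 - norm z) \<le> L * 1" using L by (intro mult_left_mono) auto
    then show ?thesis using True decay[OF True] by (simp add: indicator_def)
  qed (use out L in \<open>auto simp: indicator_def\<close>)
  have intphi: "integrable lebesgue (\<lambda>z. \<phi> (z + h *\<^sub>R v))" for h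
  proof (rule Bochner_Integration.integrable_bound)
    show "integrable lebesgue (\<lambda>z. L * indicator (cball (0 - h *\<^sub>R v) 1) z)"
      by (intro integrable_mult_right integrable_real_indicator)
        (auto simp: emeasure_lborel_cball_finite[unfolded infinity_ennreal_def])
    show "AE z in lebesgue. norm (\<phi> (z + h *\<^sub>R v)) \<le> norm (L * indicator (cball (0 - h *\<^sub>R v) 1) z)"
    proof (rule AE_I2)
      fix z
      have "norm (\<phi> (z + h *\<^sub>R v)) \<le> L * indicator (cball 0 1) (z + h *\<^sub>R v)"
        using bphi[of "z + h *\<^sub>R v"] by simp
      also have "\<dots> \<le> norm (L * indicator (cball (0 - h *\<^sub>R v) 1) z)"
      proof -
        have "0 - h *\<^sub>R v - z = 0 - (z + h *\<^sub>R v)" by simp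
        then have "dist (0 - h *\<^sub>R v) z = dist 0 (z + h *\<^sub>R v)"
          unfolding dist_norm by (metis norm_minus_cancel diff_0)
        then have "(z \<in> cball (0 - h *\<^sub>R v) 1) = (z + h *\<^sub>R v \<in> cball 0 1)"
          unfolding mem_cball by metis
        then show ?thesis using L unfolding indicator_def by auto
      qed
      finally show "norm (\<phi> (z + h *\<^sub>R v)) \<le> norm (L * indicator (cball (0 - h *\<^sub>R v) 1) z)" .
    qed
  qed (rule sh)
  have "integral\<^sup>L lebesgue (s n) = 0" for n
    unfolding s_def using intphi[of 0] intphi[of "1 / real (Suc n)"] sh(2)[of "1 / real (Suc n)"]
    by (simp add: Bochner_Integration.integral_diff)
  moreover have "(\<lambda>n. integral\<^sup>L lebesgue (s n)) \<longlonglongrightarrow>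
      integral\<^sup>L lebesgue (\<lambda>z. indicator (ball 0 1) z *\<^sub>R D z)"
  proof (rule integral_dominated_convergence)
    show "(\<lambda>z. indicator (ball 0 1) z *\<^sub>R D z) \<in> borel_measurable lebesgue"
      using measD borel_measurable_restrict_space_iff[of "ball 0 1" lebesgue D] by simp
    show "s n \<in> borel_measurable lebesgue" for n
      unfolding s_def using sh(1) meas by (intro borel_measurable_times borel_measurable_diff) auto
    show "integrable lebesgue (\<lambda>z. L' * indicator (cball 0 (1 + norm v)) z)"
      by (intro integrable_mult_right integrable_real_indicator)
        (auto simp: emeasure_lborel_cball_finite[unfolded infinity_ennreal_def])
    show "AE z in lebesgue. norm (s n z) \<le> L' * indicator (cball 0 (1 + norm v)) z" for n
    proof (rule AE_I2)
      fix z
      show "norm (s n z) \<le> L' * indicator (cball 0 (1 + norm v)) z"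
      proof (cases "norm z \<le> 1 + norm v")
        case True
        have "norm (s n z) = \<bar>\<phi> (z + (1 / real (Suc n)) *\<^sub>R v) - \<phi> z\<bar> * real (Suc n)"
          by (simp add: s_def abs_mult)
        also have "\<dots> \<le> (L' * \<bar>1 / real (Suc n)\<bar>) * real (Suc n)"
          by (intro mult_right_mono bnd) auto
        finally show ?thesis using True by (simp add: indicator_def)
      next
        case False
        have "norm z \<le> norm (z + (1 / real (Suc n)) *\<^sub>R v) + norm ((1 / real (Suc n)) *\<^sub>R v)"
          using norm_triangle_ineq4[of "z + (1 / real (Suc n)) *\<^sub>R v" "(1 / real (Suc n)) *\<^sub>R v"] by simp
        with False zero[of n] norm_ge_zero[of v]
        have "\<not> norm (z + (1 / real (Suc n)) *\<^sub>R v) < 1" "\<not> norm z < 1"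
          by linarith+
        then have "z + (1 / real (Suc n)) *\<^sub>R v \<notin> ball 0 1" "z \<notin> ball 0 1"
          unfolding mem_ball dist_0_norm .
        then show ?thesis using False by (simp add: s_def out)
      qed
    qed
    \<comment> \<open>On the sphere itself the quotients need not converge; it is a null
      set.\<close>
    have "AE z in lebesgue. z \<notin> sphere (0::'a) 1"
      using negligible_sphere[of "0::'a" 1] unfolding negligible_iff_null_sets by (rule AE_not_in)
    then show "AE z in lebesgue. (\<lambda>n. s n z) \<longlonglongrightarrow> indicator (ball 0 1) z *\<^sub>R D z"
    proof eventually_elim
      case (elim z)
      have t0: "(\<lambda>n. 1 / real (Suc n)) \<longlonglongrightarrow> 0"
        by (rule lim_1_over_n[THEN LIMSEQ_Suc])
      show ?case
      proof (cases "z \<in> ball 0 1")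
        case True
        have "((\<lambda>h. (\<phi> (z + (0 + h) *\<^sub>R v) - \<phi> (z + 0 *\<^sub>R v)) / h) \<longlongrightarrow> D z) (at 0)"
          using der[OF True] unfolding DERIV_def by simp
        moreover have "filterlim (\<lambda>n. 1 / real (Suc n)) (at 0) sequentially"
          using t0 by (simp add: filterlim_at)
        ultimately have "(\<lambda>n. (\<phi> (z + (0 + 1 / real (Suc n)) *\<^sub>R v) - \<phi> (z + 0 *\<^sub>R v)) / (1 / real (Suc n)))
            \<longlonglongrightarrow> D z"
          by (rule filterlim_compose)
        then show ?thesis using True by (simp add: s_def indicator_def)
      next
        case False
        with elim have z: "norm z > 1" by simp
        have "(\<lambda>n. norm (z + (1 / real (Suc n)) *\<^sub>R v)) \<longlonglongrightarrow> norm (z + 0 *\<^sub>R v)"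
          by (intro tendsto_intros t0)
        then have "\<forall>\<^sub>F n in sequentially. norm (z + (1 / real (Suc n)) *\<^sub>R v) > 1"
          using z by (intro order_tendstoD) auto
        then have "\<forall>\<^sub>F n in sequentially. s n z = 0"
          by eventually_elim (use z in \<open>auto simp: s_def out\<close>)
        then show ?thesis using False by (simp add: tendsto_eventually)
      qed
    qed
  qed
  ultimately have "integral\<^sup>L lebesgue (\<lambda>z. indicator (ball 0 1) z *\<^sub>R D z) = 0"
    by (simp add: LIMSEQ_const_iff)
  then show ?thesis
    by (subst integral_restrict_space) auto
qed

lemma has_real_derivative_along_line:
  fixes f :: "'a::real_normed_vector \<Rightarrow> real"
  assumes "(f has_derivative f') (at z)"
  shows "((\<lambda>t. f (z + t *\<^sub>R v)) has_real_derivative f' v) (at 0)"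
proof -
  have lin: "linear f'" using assms has_derivative_linear by blast
  have "((\<lambda>t. z + t *\<^sub>R v) has_derivative (\<lambda>t. t *\<^sub>R v)) (at 0)"
    by (auto intro!: derivative_eq_intros)
  moreover have "(f has_derivative f') (at (z + 0 *\<^sub>R v))" using assms by simp
  ultimately have "((\<lambda>t. f (z + t *\<^sub>R v)) has_derivative (\<lambda>t. f' (t *\<^sub>R v))) (at 0)"
    using has_derivative_compose by blast
  then show ?thesis
    by (simp add: has_field_derivative_def linear_scale[OF lin] mult.commute mult_commute_abs)
qed

lemma one_minus_power_le: "1 - r ^ n \<le> real n * (1 - r)" if "0 \<le> r" "r \<le> 1"
  using Bernoulli_inequality[of "r - 1" n] that by (simp add: algebra_simps)

text \<open>Each coordinate of the weighted field is differentiated along its own basis vector; the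
  weight vanishes linearly at the sphere, which is the decay required there. The right-hand side
  comes from the gradient of the weight, -2(m+1) |z|^(2m) z. Large \<open>m\<close> yields the
  unweighted identity for tangential fields, \<open>m = 0\<close> the quadratic moments.\<close>

lemma integral_weighted_divergence:
  fixes U :: "'a::euclidean_space \<Rightarrow> 'a" and U' :: "'a \<Rightarrow> 'a \<Rightarrow> 'a"
  assumes der: "\<And>z. z \<in> cball 0 1 \<Longrightarrow> (U has_derivative U' z) (at z)"
    and cont: "\<And>b. b \<in> Basis \<Longrightarrow> continuous_on (cball 0 1) (\<lambda>z. U' z b)"
  shows "(LINT z|unit_ball_measure. (1 - (z \<bullet> z) ^ Suc m) * (\<Sum>b\<in>Basis. U' z b \<bullet> b)) =
    (LINT z|unit_ball_measure. 2 * real (Suc m) * (z \<bullet> z) ^ m * (U z \<bullet> z))"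
proof -
  have cU: "continuous_on (cball 0 1) U"
    by (intro continuous_at_imp_continuous_on ballI has_derivative_continuous[OF der])
  obtain C where C: "C > 0" "\<And>z. z \<in> cball 0 1 \<Longrightarrow> norm (U z) \<le> C"
    using bounded_cball_continuous[OF cU] by blast
  define D where "D b z = (1 - (z \<bullet> z) ^ Suc m) * (U' z b \<bullet> b) -
    2 * real (Suc m) * (z \<bullet> z) ^ m * (z \<bullet> b) * (U z \<bullet> b)" for b z
  have cD: "continuous_on (cball 0 1) (D b)" if "b \<in> Basis" for b
    unfolding D_def by (intro continuous_intros cont cU that)
  have D0: "integral\<^sup>L unit_ball_measure (D b) = 0" if b: "b \<in> Basis" for b
  proof -
    define \<phi> where "\<phi> z = indicator (ball 0 1) z *\<^sub>R ((1 - (z \<bullet> z) ^ Suc m) * (U z \<bullet> b))" for z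
    obtain K where K: "K > 0" "\<And>z. z \<in> cball 0 1 \<Longrightarrow> norm (D b z) \<le> K"
      using bounded_cball_continuous[OF cD[OF b]] by blast
    \<comment> \<open>\<open>K\<close> bounds the derivative; the second summand is the decay rate,
      by Bernoulli's inequality for the exponent 2(m+1).\<close>
    define L where "L = K + 2 * real (Suc m) * C"
    show ?thesis
    proof (rule integral_directional_derivative_eq_0[where \<phi>=\<phi> and v=b and L=L])
      have "(\<lambda>z. (1 - (z \<bullet> z) ^ Suc m) * (U z \<bullet> b)) \<in> borel_measurable unit_ball_measure"
        by (intro measurable_ball_continuous continuous_intros cU)
      then show "\<phi> \<in> borel_measurable lebesgue"
        unfolding \<phi>_def
        by (subst (asm) borel_measurable_restrict_space_iff) auto
      show "D b \<in> borel_measurable unit_ball_measure"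
        by (intro measurable_ball_continuous cD b)
      show "\<phi> z = 0" if "z \<notin> ball 0 1" for z using that by (simp add: \<phi>_def)
      show "\<bar>D b z\<bar> \<le> L" if "z \<in> ball 0 1" for z
      proof -
        have "\<bar>D b z\<bar> \<le> K" using K(2)[of z] that by simp
        also have "\<dots> \<le> L" using C(1) by (simp add: L_def)
        finally show ?thesis .
      qed
      show "\<bar>\<phi> z\<bar> \<le> L * (1 - norm z)" if z: "z \<in> ball 0 1" for z
      proof -
        have nz: "norm z < 1" using z by simp
        have Ub: "\<bar>U z \<bullet> b\<bar> \<le> C"
          using Basis_le_norm[OF b, of "U z"] C(2)[of z] z by auto
        have zz: "z \<bullet> z = norm z ^ 2" by (simp add: power2_norm_eq_inner)
        have "0 \<le> 1 - (z \<bullet> z) ^ Suc m"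
          unfolding zz power_mult[symmetric] using nz by (simp add: power_le_one del: power_Suc mult_Suc_right)
        moreover have "1 - (z \<bullet> z) ^ Suc m \<le> real (2 * Suc m) * (1 - norm z)"
          unfolding zz power_mult[symmetric] using nz by (intro one_minus_power_le) auto
        ultimately have "\<bar>(1 - (z \<bullet> z) ^ Suc m) * (U z \<bullet> b)\<bar> \<le> (real (2 * Suc m) * (1 - norm z)) * C"
          unfolding abs_mult using Ub nz by (intro mult_mono) auto
        also have "\<dots> \<le> L * (1 - norm z)"
          using nz K(1) by (simp add: L_def algebra_simps)
        finally show ?thesis using z by (simp add: \<phi>_def)
      qed
      show "((\<lambda>t. \<phi> (z + t *\<^sub>R b)) has_real_derivative D b z) (at 0)" if z: "z \<in> ball 0 1" for z
      proof (rule has_field_derivative_transform_within_open)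
        let ?F = "\<lambda>z. (1 - (z \<bullet> z) ^ Suc m) * (U z \<bullet> b)"
        have "(?F has_derivative (\<lambda>h. (1 - (z \<bullet> z) ^ Suc m) * (U' z h \<bullet> b) -
            2 * real (Suc m) * (z \<bullet> z) ^ m * (z \<bullet> h) * (U z \<bullet> b))) (at z)"
        proof -
          have "((\<lambda>z. z \<bullet> z) has_derivative (\<lambda>h. 2 * (z \<bullet> h))) (at z)"
            by (auto intro!: derivative_eq_intros simp: inner_commute)
          from has_derivative_power[OF this, of "Suc m"]
          have "((\<lambda>z. (z \<bullet> z) ^ Suc m) has_derivative
              (\<lambda>h. real (Suc m) * (2 * (z \<bullet> h)) * (z \<bullet> z) ^ m)) (at z)"
            by (simp only: diff_Suc_1)
          moreover have "((\<lambda>z. U z \<bullet> b) has_derivative (\<lambda>h. U' z h \<bullet> b)) (at z)"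
            using der[of z] z by (intro has_derivative_inner_left) auto
          ultimately show ?thesis
            by (rule has_derivative_eq_rhs[OF has_derivative_mult[OF has_derivative_diff[OF has_derivative_const]]])
              (simp add: fun_eq_iff algebra_simps)
        qed
        from has_real_derivative_along_line[OF this, of b]
        show "((\<lambda>t. ?F (z + t *\<^sub>R b)) has_real_derivative D b z) (at 0)"
          by (simp add: D_def)
        show "open ((\<lambda>t. z + t *\<^sub>R b) -` ball 0 1)"
          by (intro open_vimage continuous_intros) auto
      qed (use z in \<open>auto simp: \<phi>_def\<close>)
    qed
  qed
  have eq: "(\<Sum>b\<in>Basis. D b z) = (1 - (z \<bullet> z) ^ Suc m) * (\<Sum>b\<in>Basis. U' z b \<bullet> b) -
      2 * real (Suc m) * (z \<bullet> z) ^ m * (U z \<bullet> z)" for z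
    unfolding D_def euclidean_inner[of "U z" z]
    by (simp add: sum_subtractf sum_distrib_left mult_ac del: power_Suc)
  have i1: "integrable unit_ball_measure (\<lambda>z. (1 - (z \<bullet> z) ^ Suc m) * (\<Sum>b\<in>Basis. U' z b \<bullet> b))"
    by (intro integrable_ball_continuous continuous_intros cont)
  have i2: "integrable unit_ball_measure (\<lambda>z. 2 * real (Suc m) * (z \<bullet> z) ^ m * (U z \<bullet> z))"
    by (intro integrable_ball_continuous continuous_intros cU)
  have "(LINT z|unit_ball_measure. (\<Sum>b\<in>Basis. D b z)) = 0"
    by (subst Bochner_Integration.integral_sum) (use D0 integrable_ball_continuous[OF cD] in auto)
  then show ?thesis
    unfolding eq using Bochner_Integration.integral_diff[OF i1 i2] by simp
qed

text \<open>The weights \<open>1 - |z|^(2n)\<close> increase to the indicator of the ball, and tangency of \<open>U\<close> to the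
  sphere makes the contribution of their gradients vanish in the limit.\<close>

lemma integral_divergence_tangential:
  fixes U :: "'a::euclidean_space \<Rightarrow> 'a" and U' :: "'a \<Rightarrow> 'a \<Rightarrow> 'a"
  assumes der: "\<And>z. z \<in> cball 0 1 \<Longrightarrow> (U has_derivative U' z) (at z)"
    and cont: "\<And>b. b \<in> Basis \<Longrightarrow> continuous_on (cball 0 1) (\<lambda>z. U' z b)"
    and tang: "\<And>z. z \<in> cball 0 1 \<Longrightarrow> U z \<bullet> z = (1 - z \<bullet> z) * K z"
    and cK: "continuous_on (cball 0 1) K"
  shows "(LINT z|unit_ball_measure. (\<Sum>b\<in>Basis. U' z b \<bullet> b)) = 0"
proof -
  have cU: "continuous_on (cball 0 1) U"
    by (intro continuous_at_imp_continuous_on ballI has_derivative_continuous[OF der])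
  have cdiv: "continuous_on (cball 0 1) (\<lambda>z. \<Sum>b\<in>Basis. U' z b \<bullet> b)"
    by (intro continuous_intros cont)
  obtain C where C: "C > 0" "\<And>z. z \<in> cball 0 1 \<Longrightarrow> norm (K z) \<le> C"
    using bounded_cball_continuous[OF cK] by blast
  have zz: "0 \<le> z \<bullet> z" "z \<bullet> z < 1" if "z \<in> ball 0 1" for z :: 'a
    using that by (auto simp: dot_square_norm power_less_one_iff)
  have int1: "integrable unit_ball_measure (\<lambda>z::'a. c)" for c :: real
    by (intro integrable_ball_continuous continuous_intros)
  have "(\<lambda>m. LINT z|unit_ball_measure. (1 - (z \<bullet> z) ^ Suc m) * (\<Sum>b\<in>Basis. U' z b \<bullet> b))
      \<longlonglongrightarrow> (LINT z|unit_ball_measure. (\<Sum>b\<in>Basis. U' z b \<bullet> b))"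
  proof (rule integral_dominated_convergence)
    show "integrable unit_ball_measure (\<lambda>z. \<bar>\<Sum>b\<in>Basis. U' z b \<bullet> b\<bar>)"
      by (intro integrable_abs integrable_ball_continuous cdiv)
    show "AE z in unit_ball_measure. norm ((1 - (z \<bullet> z) ^ Suc m) * (\<Sum>b\<in>Basis. U' z b \<bullet> b))
        \<le> \<bar>\<Sum>b\<in>Basis. U' z b \<bullet> b\<bar>" for m
    proof (rule AE_I2)
      fix z :: 'a assume "z \<in> space unit_ball_measure"
      then have z: "z \<in> ball 0 1" by (simp add: space_restrict_space)
      have "\<bar>1 - (z \<bullet> z) ^ Suc m\<bar> \<le> 1"
        using zz[OF z] by (simp add: power_le_one mult_le_one del: power_Suc)
      then show "norm ((1 - (z \<bullet> z) ^ Suc m) * (\<Sum>b\<in>Basis. U' z b \<bullet> b)) \<le> \<bar>\<Sum>b\<in>Basis. U' z b \<bullet> b\<bar>"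
        unfolding real_norm_def abs_mult by (intro mult_left_le_one_le) auto
    qed
    show "AE z in unit_ball_measure. (\<lambda>m. (1 - (z \<bullet> z) ^ Suc m) * (\<Sum>b\<in>Basis. U' z b \<bullet> b))
        \<longlonglongrightarrow> (\<Sum>b\<in>Basis. U' z b \<bullet> b)"
    proof (rule AE_I2)
      fix z :: 'a assume "z \<in> space unit_ball_measure"
      then have z: "z \<in> ball 0 1" by (simp add: space_restrict_space)
      have "(\<lambda>m. (1 - (z \<bullet> z) ^ Suc m) * (\<Sum>b\<in>Basis. U' z b \<bullet> b)) \<longlonglongrightarrow> (1 - 0) * (\<Sum>b\<in>Basis. U' z b \<bullet> b)"
        using zz[OF z] by (intro tendsto_intros LIMSEQ_Suc[OF LIMSEQ_power_zero]) auto
      then show "(\<lambda>m. (1 - (z \<bullet> z) ^ Suc m) * (\<Sum>b\<in>Basis. U' z b \<bullet> b)) \<longlonglongrightarrow> (\<Sum>b\<in>Basis. U' z b \<bullet> b)"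
        by simp
    qed
  qed (intro measurable_ball_continuous continuous_intros cont cdiv; assumption)+
  moreover have "(\<lambda>m. LINT z|unit_ball_measure. 2 * real (Suc m) * (z \<bullet> z) ^ m * (U z \<bullet> z))
      \<longlonglongrightarrow> (LINT z|(unit_ball_measure :: 'a measure). 0)"
  proof (rule integral_dominated_convergence)
    show "integrable unit_ball_measure (\<lambda>z::'a. 2 * C)" by (rule int1)
    show "AE z in unit_ball_measure. norm (2 * real (Suc m) * (z \<bullet> z) ^ m * (U z \<bullet> z)) \<le> 2 * C" for m
    proof (rule AE_I2)
      fix z :: 'a assume "z \<in> space unit_ball_measure"
      then have z: "z \<in> ball 0 1" by (simp add: space_restrict_space)
      define t where "t = z \<bullet> z"
      have t: "0 \<le> t" "t < 1" using zz[OF z] by (auto simp: t_def)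
      \<comment> \<open>The factor m+1 grows, but m+1 copies of t^m lie below the geometric sum (1 -
        t^(m+1)) / (1 - t). The factor 1 - t supplied by tangency therefore gives a bound uniform in
        \<open>m\<close>.\<close>
      have "real (Suc m) * t ^ m = (\<Sum>i<Suc m. t ^ m)" by simp
      also have "\<dots> \<le> (\<Sum>i<Suc m. t ^ i)"
        using t by (intro sum_mono power_decreasing) auto
      also have "\<dots> = (1 - t ^ Suc m) / (1 - t)" using t by (subst sum_gp_strict) auto
      finally have "real (Suc m) * t ^ m * (1 - t) \<le> 1 - t ^ Suc m"
        using t by (simp add: field_simps)
      also have "\<dots> \<le> 1" using t by simp
      finally have *: "real (Suc m) * t ^ m * (1 - t) \<le> 1" .
      have "norm (2 * real (Suc m) * t ^ m * (U z \<bullet> z)) = 2 * (real (Suc m) * t ^ m * (1 - t)) * \<bar>K z\<bar>"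
        using tang[of z] z t by (simp add: abs_mult t_def)
      also have "\<dots> \<le> 2 * 1 * C"
        using C(1) C(2)[of z] z t * by (intro mult_mono) auto
      finally show "norm (2 * real (Suc m) * (z \<bullet> z) ^ m * (U z \<bullet> z)) \<le> 2 * C" by (simp add: t_def)
    qed
    show "AE z in unit_ball_measure. (\<lambda>m. 2 * real (Suc m) * (z \<bullet> z) ^ m * (U z \<bullet> z)) \<longlonglongrightarrow> 0"
    proof (rule AE_I2)
      fix z :: 'a assume "z \<in> space unit_ball_measure"
      then have z: "z \<in> ball 0 1" by (simp add: space_restrict_space)
      have "(\<lambda>m. 2 * (real m * (z \<bullet> z) ^ m + (z \<bullet> z) ^ m) * (U z \<bullet> z)) \<longlonglongrightarrow> 2 * (0 + 0) * (U z \<bullet> z)"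
        using zz[OF z] by (intro tendsto_intros LIMSEQ_power_zero powser_times_n_limit_0) auto
      then show "(\<lambda>m. 2 * real (Suc m) * (z \<bullet> z) ^ m * (U z \<bullet> z)) \<longlonglongrightarrow> 0"
        by (simp add: algebra_simps)
    qed
  qed (auto intro!: measurable_ball_continuous continuous_intros cU)
  moreover have "(LINT z|unit_ball_measure. (1 - (z \<bullet> z) ^ Suc m) * (\<Sum>b\<in>Basis. U' z b \<bullet> b)) =
      (LINT z|unit_ball_measure. 2 * real (Suc m) * (z \<bullet> z) ^ m * (U z \<bullet> z))" for m
    by (rule integral_weighted_divergence) (rule der cont; assumption)+
  ultimately show ?thesis
    unfolding Bochner_Integration.integral_zero by (simp only: LIMSEQ_unique)
qed

section \<open>Signed powers\<close>

text \<open>Up to the factor q + 1 this is the derivative of |s|^(q+1). For \<open>q = 0\<close> it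
  is \<open>sgn\<close>, a selection from the subdifferential of the absolute value, so that p = 1
  is treated together with p > 1.\<close>

definition signed_powr :: "real \<Rightarrow> real \<Rightarrow> real" where
  "signed_powr q s = sgn s * \<bar>s\<bar> powr q"

lemma mult_signed_powr: "s * signed_powr q s = \<bar>s\<bar> powr (q + 1)"
proof (cases "s = 0")
  case False
  then have "s * sgn s = \<bar>s\<bar>" by (simp add: abs_sgn)
  then show ?thesis using False by (simp add: signed_powr_def powr_add mult.assoc[symmetric] mult.commute)
qed (simp add: signed_powr_def)

lemma signed_powr_0 [simp]: "signed_powr q 0 = 0"
  by (simp add: signed_powr_def)

lemma signed_powr_minus [simp]: "signed_powr q (- s) = - signed_powr q s"
  by (simp add: signed_powr_def sgn_minus)

lemma signed_powr_mult: "c > 0 \<Longrightarrow> signed_powr q (c * s) = c powr q * signed_powr q s"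
  by (simp add: signed_powr_def sgn_mult abs_mult powr_mult)

lemma abs_signed_powr_le: "q \<ge> 0 \<Longrightarrow> \<bar>s\<bar> \<le> C \<Longrightarrow> \<bar>signed_powr q s\<bar> \<le> C powr q"
  by (cases "s = 0") (auto simp: signed_powr_def abs_mult intro: powr_mono2)

text \<open>Supporting line of the convex function |s|^(q+1). It follows from Young's inequality
  with the conjugate exponents (q+1)/q and q+1 instead of from differentiation, so it includes the
  kink at \<open>q = 0\<close>.\<close>

lemma abs_powr_diff_ge:
  assumes q: "q \<ge> 0"
  shows "(q + 1) * signed_powr q a * (b - a) \<le> \<bar>b\<bar> powr (q + 1) - \<bar>a\<bar> powr (q + 1)"
proof -
  have y: "(q + 1) * (\<bar>a\<bar> powr q * \<bar>b\<bar>) \<le> q * \<bar>a\<bar> powr (q + 1) + \<bar>b\<bar> powr (q + 1)"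
  proof (cases "q = 0")
    case True
    then show ?thesis by simp
  next
    case False
    with q have q0: "q > 0" by simp
    have "\<bar>a\<bar> powr q * \<bar>b\<bar> \<le> (\<bar>a\<bar> powr q) powr ((q + 1) / q) / ((q + 1) / q) + \<bar>b\<bar> powr (q + 1) / (q + 1)"
      using q0 by (intro Youngs_inequality) (auto simp: field_simps)
    also have "(\<bar>a\<bar> powr q) powr ((q + 1) / q) = \<bar>a\<bar> powr (q + 1)"
      using q0 by (simp add: powr_powr)
    finally have "\<bar>a\<bar> powr q * \<bar>b\<bar> \<le> (q * \<bar>a\<bar> powr (q + 1) + \<bar>b\<bar> powr (q + 1)) / (q + 1)"
      by (simp only: divide_divide_eq_right add_divide_distrib[of "q * _"] mult.commute)
    then show ?thesis using q0 by (simp add: pos_le_divide_eq mult.commute)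
  qed
  have "signed_powr q a * b \<le> \<bar>a\<bar> powr q * \<bar>b\<bar>"
    by (rule order_trans[OF abs_ge_self])
      (cases "a = 0"; simp add: signed_powr_def abs_mult)
  then have "(q + 1) * (signed_powr q a * b) \<le> (q + 1) * (\<bar>a\<bar> powr q * \<bar>b\<bar>)"
    using q by (intro mult_left_mono) auto
  moreover have "(q + 1) * signed_powr q a * (b - a) = (q + 1) * (signed_powr q a * b) - (q + 1) * \<bar>a\<bar> powr (q + 1)"
    unfolding mult_signed_powr[symmetric] by (simp add: algebra_simps)
  ultimately show ?thesis using y by (simp add: algebra_simps)
qed

lemma isCont_signed_powr:
  assumes "q > 0 \<or> s \<noteq> 0"
  shows "isCont (signed_powr q) s"
proof (cases "s = 0")
  case False
  then have "isCont sgn s" by (rule isCont_sgn[OF continuous_ident])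
  then show ?thesis
    unfolding signed_powr_def using False by (intro continuous_intros) auto
next
  case True
  with assms have q: "q > 0" by simp
  have "((\<lambda>s. \<bar>s\<bar> powr q) \<longlongrightarrow> \<bar>0\<bar> powr q) (at 0)"
    by (rule tendsto_powr') (use q in \<open>auto intro!: tendsto_intros tendsto_rabs_zero\<close>)
  then have "((\<lambda>s. \<bar>s\<bar> powr q) \<longlongrightarrow> 0) (at 0)" using q by simp
  then have "(signed_powr q \<longlongrightarrow> 0) (at 0)"
    by (rule Lim_null_comparison[rotated]) (auto simp: signed_powr_def abs_mult abs_sgn_eq)
  then show ?thesis using True by (simp add: isCont_def)
qed

lemma continuous_on_signed_powr:
  assumes "q > 0" "continuous_on S f"
  shows "continuous_on S (\<lambda>z. signed_powr q (f z))"
proof -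
  have "continuous_on UNIV (signed_powr q)"
    using assms(1) isCont_signed_powr by (simp add: continuous_at_imp_continuous_on)
  then show ?thesis
    using assms(2) by (rule continuous_on_compose2) auto
qed

lemma borel_measurable_signed_powr [measurable]: "signed_powr q \<in> borel_measurable borel"
  unfolding signed_powr_def[abs_def] by measurable

lemma continuous_on_abs_powr [continuous_intros]:
  assumes "q \<ge> 0" "continuous_on S f"
  shows "continuous_on S (\<lambda>z. \<bar>f z :: real\<bar> powr (q + 1))"
  using assms by (intro continuous_on_powr' continuous_intros) auto

text \<open>The tangent inequality \<open>abs_powr_diff_ge\<close>, used at both end points, squeezes the difference
  quotient between two values of \<open>signed_powr q\<close>.\<close>

lemma has_real_derivative_abs_powr:
  assumes q: "q > 0"
  shows "((\<lambda>s. \<bar>s\<bar> powr (q + 1)) has_real_derivative (q + 1) * signed_powr q s) (at s)"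
proof -
  let ?g = "\<lambda>s. (q + 1) * signed_powr q s"
  have lim: "(?g \<longlongrightarrow> ?g s) (at s)"
    using isCont_signed_powr[of q s] q unfolding isCont_def by (intro tendsto_intros) auto
  have "((\<lambda>y. \<bar>?g y - ?g s\<bar>) \<longlongrightarrow> 0) (at s)"
    using tendsto_rabs[OF tendsto_diff[OF lim tendsto_const[of "?g s"]]] by simp
  then have "((\<lambda>y. (\<bar>y\<bar> powr (q + 1) - \<bar>s\<bar> powr (q + 1)) / (y - s) - ?g s) \<longlongrightarrow> 0) (at s)"
  proof (rule Lim_null_comparison[rotated])
    show "\<forall>\<^sub>F y in at s. norm ((\<bar>y\<bar> powr (q + 1) - \<bar>s\<bar> powr (q + 1)) / (y - s) - ?g s) \<le> \<bar>?g y - ?g s\<bar>"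
    proof (rule eventually_mono[OF eventually_neq_at_within[of s]])
      fix y assume "y \<noteq> s"
      define d where "d = \<bar>y\<bar> powr (q + 1) - \<bar>s\<bar> powr (q + 1)"
      have 1: "?g s * (y - s) \<le> d"
        using abs_powr_diff_ge[of q s y] q by (simp add: d_def)
      have 2: "d \<le> ?g y * (y - s)"
        using abs_powr_diff_ge[of q y s] q by (simp add: d_def algebra_simps)
      consider "y > s" | "y < s" using \<open>y \<noteq> s\<close> by linarith
      then have "?g s \<le> d / (y - s) \<and> d / (y - s) \<le> ?g y \<or> ?g y \<le> d / (y - s) \<and> d / (y - s) \<le> ?g s"
      proof cases
        case 1 then show ?thesis
          using \<open>?g s * (y - s) \<le> d\<close> 2 by (auto simp: pos_le_divide_eq pos_divide_le_eq)
      next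
        case 2 then show ?thesis
          using \<open>d \<le> ?g y * (y - s)\<close> 1 by (auto simp: neg_le_divide_eq neg_divide_le_eq)
      qed
      then show "norm ((\<bar>y\<bar> powr (q + 1) - \<bar>s\<bar> powr (q + 1)) / (y - s) - ?g s) \<le> \<bar>?g y - ?g s\<bar>"
        unfolding d_def[symmetric] real_norm_def by linarith
    qed
  qed
  then show ?thesis
    unfolding has_field_derivative_iff by (simp add: Lim_null[symmetric])
qed

section \<open>Integrals of signed powers of continuous functions, and the passage to exponent
  zero\<close>

lemma measurable_signed_powr_continuous:
  fixes f h :: "'a::euclidean_space \<Rightarrow> real"
  assumes "continuous_on (cball x e) f" "continuous_on (cball x e) h"
  shows "(\<lambda>z. signed_powr q (f z) * h z) \<in> borel_measurable (lebesgue_on (ball x e))"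
  using measurable_ball_continuous[OF assms(1)] measurable_ball_continuous[OF assms(2)] by measurable

lemma integrable_signed_powr_continuous:
  fixes f h :: "'a::euclidean_space \<Rightarrow> real"
  assumes q: "q \<ge> 0" and f: "continuous_on (cball x e) f" and h: "continuous_on (cball x e) h"
  shows "integrable (lebesgue_on (ball x e)) (\<lambda>z. signed_powr q (f z) * h z)"
proof -
  obtain C where C: "\<And>z. z \<in> cball x e \<Longrightarrow> norm (f z) \<le> C"
    using bounded_cball_continuous[OF f] by blast
  obtain K where K: "K > 0" "\<And>z. z \<in> cball x e \<Longrightarrow> norm (h z) \<le> K"
    using bounded_cball_continuous[OF h] by blast
  show ?thesis
  proof (rule integrable_ball_bounded[where C="C powr q * K"])
    fix z assume "z \<in> ball x e"
    then have "z \<in> cball x e" by simp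
    then show "\<bar>signed_powr q (f z) * h z\<bar> \<le> C powr q * K"
      unfolding abs_mult using C[of z] K(2)[of z] abs_signed_powr_le[OF q, of "f z" C]
      by (intro mult_mono) auto
  qed (rule measurable_signed_powr_continuous[OF f h])
qed

text \<open>Extends to \<open>q = 0\<close> the identities whose proof differentiates |s|^(q+1).
  Where \<open>f\<close> vanishes every integrand is 0, so the discontinuity of \<open>sgn\<close>
  does not disturb the pointwise limit.\<close>

lemma tendsto_integral_signed_powr:
  fixes f h :: "'a::euclidean_space \<Rightarrow> real"
  assumes f: "continuous_on (cball x e) f" and h: "continuous_on (cball x e) h"
  shows "(\<lambda>n. LINT z|lebesgue_on (ball x e). signed_powr (1 / real (Suc n)) (f z) * h z)
    \<longlonglongrightarrow> (LINT z|lebesgue_on (ball x e). signed_powr 0 (f z) * h z)"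
proof -
  obtain C where C: "C > 0" "\<And>z. z \<in> cball x e \<Longrightarrow> norm (f z) \<le> C"
    using bounded_cball_continuous[OF f] by blast
  obtain K where K: "K > 0" "\<And>z. z \<in> cball x e \<Longrightarrow> norm (h z) \<le> K"
    using bounded_cball_continuous[OF h] by blast
  have t0: "(\<lambda>n. 1 / real (Suc n)) \<longlonglongrightarrow> 0"
    by (rule lim_1_over_n[THEN LIMSEQ_Suc])
  show ?thesis
  proof (rule integral_dominated_convergence)
    show "integrable (lebesgue_on (ball x e)) (\<lambda>z. (C + 1) * K)"
      by (intro integrable_ball_continuous continuous_intros)
    show "AE z in lebesgue_on (ball x e). (\<lambda>n. signed_powr (1 / real (Suc n)) (f z) * h z)
        \<longlonglongrightarrow> signed_powr 0 (f z) * h z"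
    proof (rule AE_I2)
      fix z
      show "(\<lambda>n. signed_powr (1 / real (Suc n)) (f z) * h z) \<longlonglongrightarrow> signed_powr 0 (f z) * h z"
      proof (cases "f z = 0")
        case False
        then have "(\<lambda>n. \<bar>f z\<bar> powr (1 / real (Suc n))) \<longlonglongrightarrow> \<bar>f z\<bar> powr 0"
          by (intro tendsto_powr tendsto_const t0) simp
        then show ?thesis
          unfolding signed_powr_def by (intro tendsto_mult tendsto_const)
      qed simp
    qed
    show "AE z in lebesgue_on (ball x e). norm (signed_powr (1 / real (Suc n)) (f z) * h z) \<le> (C + 1) * K" for n
    proof (rule AE_I2)
      fix z assume "z \<in> space (lebesgue_on (ball x e))"
      then have z: "z \<in> cball x e" by (auto simp: space_restrict_space)
      \<comment> \<open>The bound \<open>C\<close> is enlarged to a base at least 1, so that the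
        power increases with the exponent and exponent 1 dominates them all.\<close>
      have "\<bar>signed_powr (1 / real (Suc n)) (f z)\<bar> \<le> (C + 1) powr (1 / real (Suc n))"
        using C(1) C(2)[OF z] by (intro abs_signed_powr_le) auto
      also have "\<dots> \<le> (C + 1) powr 1"
        using C(1) by (intro powr_mono) (auto simp: field_simps)
      also have "\<dots> = C + 1" using C(1) by simp
      finally show "norm (signed_powr (1 / real (Suc n)) (f z) * h z) \<le> (C + 1) * K"
        unfolding real_norm_def abs_mult using C K(2)[OF z] by (intro mult_mono) auto
    qed
  qed (rule measurable_signed_powr_continuous[OF f h])+
qed

lemma div_const_tendsto:
  "(\<lambda>n. 1 / real (Suc n) + c) \<longlonglongrightarrow> c"
  using tendsto_add[OF lim_1_over_n[THEN LIMSEQ_Suc] tendsto_const[of c]] by simp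

text \<open>Divergence identity for |f|^(q+1) Y, where Y = \<xi> - (\<xi>.z) z. The field is
  tangential because Y.z = (1 - |z|^2)(\<xi>.z), and N + 1 arises from div Y = -(N+1)(\<xi>.z). The
  factor |f|^(q+1) is written as f times its signed power, so both sides carry the same
  weight.\<close>

lemma integral_tangential_field_signed_powr:
  fixes f :: "'a::euclidean_space \<Rightarrow> real" and df :: "'a \<Rightarrow> 'a" and \<xi> :: 'a
  assumes q: "q \<ge> 0"
    and der: "\<And>z. z \<in> cball 0 1 \<Longrightarrow> (f has_derivative (\<lambda>h. df z \<bullet> h)) (at z)"
    and cdf: "continuous_on (cball 0 1) df"
  shows "(q + 1) * (LINT z|unit_ball_measure. signed_powr q (f z) * (df z \<bullet> (\<xi> - (\<xi> \<bullet> z) *\<^sub>R z))) =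
    (real DIM('a) + 1) * (LINT z|unit_ball_measure. signed_powr q (f z) * (f z * (\<xi> \<bullet> z)))"
proof -
  have cf: "continuous_on (cball 0 1) f"
    by (intro continuous_at_imp_continuous_on ballI has_derivative_continuous[OF der])
  have pos: "(r + 1) * (LINT z|unit_ball_measure. signed_powr r (f z) * (df z \<bullet> (\<xi> - (\<xi> \<bullet> z) *\<^sub>R z))) =
    (real DIM('a) + 1) * (LINT z|unit_ball_measure. signed_powr r (f z) * (f z * (\<xi> \<bullet> z)))"
    if r: "r > 0" for r
  proof -
    define U where "U z = (\<bar>f z\<bar> powr (r + 1)) *\<^sub>R (\<xi> - (\<xi> \<bullet> z) *\<^sub>R z)" for z
    define U' where "U' z h = ((r + 1) * signed_powr r (f z) * (df z \<bullet> h)) *\<^sub>R (\<xi> - (\<xi> \<bullet> z) *\<^sub>R z)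
        - (\<bar>f z\<bar> powr (r + 1)) *\<^sub>R ((\<xi> \<bullet> h) *\<^sub>R z + (\<xi> \<bullet> z) *\<^sub>R h)" for z h
    have "(LINT z|unit_ball_measure. (\<Sum>b\<in>Basis. U' z b \<bullet> b)) = 0"
    proof (rule integral_divergence_tangential)
      fix z :: 'a assume z: "z \<in> cball 0 1"
      have "((\<lambda>z. \<bar>f z\<bar> powr (r + 1)) has_derivative (\<lambda>h. (r + 1) * signed_powr r (f z) * (df z \<bullet> h))) (at z)"
        using has_derivative_compose[OF der[OF z]
            has_real_derivative_abs_powr[OF r, unfolded has_field_derivative_def]] by simp
      moreover have "((\<lambda>z. \<xi> - (\<xi> \<bullet> z) *\<^sub>R z) has_derivative (\<lambda>h. - ((\<xi> \<bullet> h) *\<^sub>R z + (\<xi> \<bullet> z) *\<^sub>R h))) (at z)"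
        by (auto intro!: derivative_eq_intros simp: algebra_simps)
      ultimately show "(U has_derivative U' z) (at z)"
        unfolding U_def
        by (rule has_derivative_eq_rhs[OF has_derivative_scaleR]) (simp add: fun_eq_iff U'_def algebra_simps)
      show "U z \<bullet> z = (1 - z \<bullet> z) * (\<bar>f z\<bar> powr (r + 1) * (\<xi> \<bullet> z))"
        by (simp add: U_def algebra_simps)
    next
      show "continuous_on (cball 0 1) (\<lambda>z. U' z b)" for b
        unfolding U'_def using r by (intro continuous_intros continuous_on_signed_powr cf cdf) auto
      show "continuous_on (cball 0 1) (\<lambda>z. \<bar>f z\<bar> powr (r + 1) * (\<xi> \<bullet> z))"
        using r by (intro continuous_intros cf) auto
    qed
    moreover have "(\<Sum>b\<in>Basis. U' z b \<bullet> b) =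
       (r + 1) * (signed_powr r (f z) * (df z \<bullet> (\<xi> - (\<xi> \<bullet> z) *\<^sub>R z))) -
       (real DIM('a) + 1) * (signed_powr r (f z) * (f z * (\<xi> \<bullet> z)))" for z
    proof -
      have "(\<Sum>b\<in>Basis. U' z b \<bullet> b) = (r + 1) * signed_powr r (f z) *
          (\<Sum>b\<in>Basis. (df z \<bullet> b) * ((\<xi> - (\<xi> \<bullet> z) *\<^sub>R z) \<bullet> b)) -
          \<bar>f z\<bar> powr (r + 1) * ((\<Sum>b\<in>Basis. (\<xi> \<bullet> b) * (z \<bullet> b)) + (\<xi> \<bullet> z) * (\<Sum>b\<in>(Basis::'a set). b \<bullet> b))"
        unfolding U'_def
        by (simp only: inner_diff_left inner_add_left inner_scaleR_left sum_subtractf sum.distrib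
            sum_distrib_left distrib_left mult.assoc)
      also have "(\<Sum>b\<in>(Basis::'a set). b \<bullet> b) = real DIM('a)"
        by (simp add: inner_Basis)
      finally show ?thesis
        unfolding euclidean_inner[symmetric] mult_signed_powr[symmetric] by (simp add: algebra_simps)
    qed
    ultimately show ?thesis
      using r integrable_signed_powr_continuous[of r 0 1 f "\<lambda>z. df z \<bullet> (\<xi> - (\<xi> \<bullet> z) *\<^sub>R z)"]
        integrable_signed_powr_continuous[of r 0 1 f "\<lambda>z. f z * (\<xi> \<bullet> z)"] cf cdf
      by (simp add: continuous_intros)
  qed
  show ?thesis
  proof (cases "q = 0")
    case False
    then show ?thesis using q pos by simp
  next
    case True
    have "(\<lambda>n. (1 / real (Suc n) + 1) *
        (LINT z|unit_ball_measure. signed_powr (1 / real (Suc n)) (f z) * (df z \<bullet> (\<xi> - (\<xi> \<bullet> z) *\<^sub>R z))))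
      \<longlonglongrightarrow> 1 * (LINT z|unit_ball_measure. signed_powr 0 (f z) * (df z \<bullet> (\<xi> - (\<xi> \<bullet> z) *\<^sub>R z)))"
      by (intro tendsto_mult div_const_tendsto tendsto_integral_signed_powr cf continuous_intros cdf)
    moreover have "(\<lambda>n. (real DIM('a) + 1) *
        (LINT z|unit_ball_measure. signed_powr (1 / real (Suc n)) (f z) * (f z * (\<xi> \<bullet> z))))
      \<longlonglongrightarrow> (real DIM('a) + 1) * (LINT z|unit_ball_measure. signed_powr 0 (f z) * (f z * (\<xi> \<bullet> z)))"
      by (intro tendsto_mult tendsto_const tendsto_integral_signed_powr cf continuous_intros)
    ultimately show ?thesis
      using pos[of "1 / real (Suc _)"] True
      by (auto simp del: of_nat_Suc intro: LIMSEQ_unique)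
  qed
qed

section \<open>The first variation\<close>

lemma tendsto_integral_ball_bounded:
  fixes h :: "nat \<Rightarrow> 'a::euclidean_space \<Rightarrow> real"
  assumes "\<And>n. h n \<in> borel_measurable (lebesgue_on (ball x e))" "h0 \<in> borel_measurable (lebesgue_on (ball x e))"
    and bnd: "\<And>n z. z \<in> ball x e \<Longrightarrow> \<bar>h n z\<bar> \<le> K"
    and lim: "AE z in lebesgue_on (ball x e). z \<in> ball x e \<longrightarrow> (\<lambda>n. h n z) \<longlonglongrightarrow> h0 z"
  shows "(\<lambda>n. integral\<^sup>L (lebesgue_on (ball x e)) (h n)) \<longlonglongrightarrow> integral\<^sup>L (lebesgue_on (ball x e)) h0"
proof (rule integral_dominated_convergence)
  show "integrable (lebesgue_on (ball x e)) (\<lambda>z. K)"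
    by (intro integrable_ball_continuous continuous_intros)
  show "AE z in lebesgue_on (ball x e). norm (h n z) \<le> K" for n
    by (rule AE_I2) (use bnd in \<open>simp add: space_restrict_space\<close>)
  show "AE z in lebesgue_on (ball x e). (\<lambda>n. h n z) \<longlonglongrightarrow> h0 z"
    using lim AE_space by eventually_elim (simp add: space_restrict_space)
qed fact+

text \<open>Off this hyperplane \<open>signed_powr q\<close> is continuous at the limit value even
  for \<open>q = 0\<close>, so pointwise convergence may be checked there.\<close>

lemma AE_ball_inner_neq_0:
  fixes \<xi> :: "'a::euclidean_space"
  assumes "\<xi> \<noteq> 0"
  shows "AE z in lebesgue_on (ball x e). \<xi> \<bullet> z \<noteq> 0"
proof -
  have "{z. \<xi> \<bullet> z = 0} \<in> null_sets lebesgue"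
    using negligible_hyperplane[of \<xi> 0] assms by (simp add: negligible_iff_null_sets)
  from AE_not_in[OF this] have "AE z in lebesgue. \<xi> \<bullet> z \<noteq> 0" by simp
  then show ?thesis by (subst AE_restrict_space_iff) auto
qed

text \<open>The identity for |\<xi>|^2, multiplied by the signed power of f and integrated, turns
  the left-hand side into integrals of \<open>E\<close>, \<open>w\<close> and \<open>dw\<close> with
  no factor 1/\<epsilon> left. Each then converges by dominated convergence.\<close>

lemma tendsto_integral_signed_powr_perturbation:
  fixes f w :: "nat \<Rightarrow> 'a::euclidean_space \<Rightarrow> real" and df dw :: "nat \<Rightarrow> 'a \<Rightarrow> 'a" and \<xi> :: 'a
  assumes q: "q \<ge> 0" and \<xi>: "\<xi> \<noteq> 0"
    and \<epsilon>: "\<And>n. 0 < \<epsilon> n" "\<And>n. \<epsilon> n \<le> 1" "\<epsilon> \<longlonglongrightarrow> 0"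
    and f: "\<And>n z. z \<in> cball 0 1 \<Longrightarrow> f n z = \<xi> \<bullet> z + \<epsilon> n * w n z"
    and df: "\<And>n z. z \<in> cball 0 1 \<Longrightarrow> df n z = \<xi> + \<epsilon> n *\<^sub>R dw n z"
    and der: "\<And>n z. z \<in> cball 0 1 \<Longrightarrow> (f n has_derivative (\<lambda>h. df n z \<bullet> h)) (at z)"
    and cw: "\<And>n. continuous_on (cball 0 1) (w n)" "continuous_on (cball 0 1) w0"
    and cdw: "\<And>n. continuous_on (cball 0 1) (dw n)" "continuous_on (cball 0 1) dw0"
    and bw: "\<And>n z. z \<in> cball 0 1 \<Longrightarrow> \<bar>w n z\<bar> \<le> C"
    and bdw: "\<And>n z. z \<in> cball 0 1 \<Longrightarrow> norm (dw n z) \<le> C"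
    and lw: "\<And>z. z \<in> cball 0 1 \<Longrightarrow> (\<lambda>n. w n z) \<longlonglongrightarrow> w0 z"
    and ldw: "\<And>z. z \<in> cball 0 1 \<Longrightarrow> (\<lambda>n. dw n z) \<longlonglongrightarrow> dw0 z"
  shows "(\<lambda>n. integral\<^sup>L unit_ball_measure (\<lambda>z. signed_powr q (f n z)) / \<epsilon> n) \<longlonglongrightarrow>
    ((real DIM('a) + q + 1) * (LINT z|unit_ball_measure. signed_powr q (\<xi> \<bullet> z) * ((\<xi> \<bullet> z) * w0 z))
     - (LINT z|unit_ball_measure. signed_powr q (\<xi> \<bullet> z) * (dw0 z \<bullet> (\<xi> - (\<xi> \<bullet> z) *\<^sub>R z)))) / (\<xi> \<bullet> \<xi>)"
    (is "_ \<longlonglongrightarrow> ((?N + q + 1) * ?I - ?J) / _")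
proof -
  have C: "C \<ge> 0" using bw[of 0 0] by simp
  define A where "A = norm \<xi> + C"
  have \<xi>z: "\<bar>\<xi> \<bullet> z\<bar> \<le> norm \<xi>" if "z \<in> cball 0 1" for z
    using that Cauchy_Schwarz_ineq2[of \<xi> z] mult_left_mono[of "norm z" 1 "norm \<xi>"] by simp
  have bf: "\<bar>f n z\<bar> \<le> A" if "z \<in> cball 0 1" for n z
  proof -
    have "\<bar>\<epsilon> n * w n z\<bar> \<le> 1 * C"
      unfolding abs_mult using \<epsilon>(1,2)[of n] bw[OF that] by (intro mult_mono) auto
    then show ?thesis unfolding f[OF that] A_def using \<xi>z[OF that] by linarith
  qed
  have ba: "\<bar>\<xi> \<bullet> z\<bar> \<le> A" if "z \<in> cball 0 1" for z using \<xi>z[OF that] C by (simp add: A_def)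
  define G where "G = A powr q"
  have gf: "\<bar>signed_powr q (f n z)\<bar> \<le> G" and ga: "\<bar>signed_powr q (\<xi> \<bullet> z)\<bar> \<le> G" if "z \<in> cball 0 1" for n z
    unfolding G_def using bf[OF that] ba[OF that] q by (auto intro: abs_signed_powr_le)
  have G: "G \<ge> 0" by (simp add: G_def)
  have cf: "continuous_on (cball 0 1) (f n)" for n
    by (intro continuous_at_imp_continuous_on ballI has_derivative_continuous[OF der])
  have cdf: "continuous_on (cball 0 1) (df n)" for n
    by (subst continuous_on_cong[OF refl df]) (auto intro!: continuous_intros cdw)
  have cY: "continuous_on (cball 0 1) (\<lambda>z. \<xi> - (\<xi> \<bullet> z) *\<^sub>R z)"
    by (intro continuous_intros)
  obtain Y where Y: "Y > 0" "\<And>z. z \<in> cball 0 1 \<Longrightarrow> norm (\<xi> - (\<xi> \<bullet> z) *\<^sub>R z) \<le> Y"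
    using bounded_cball_continuous[OF cY] by blast
  have ca: "continuous_on (cball 0 1) (\<lambda>z. \<xi> \<bullet> z)" by (intro continuous_intros)
  have lf: "(\<lambda>n. f n z) \<longlonglongrightarrow> \<xi> \<bullet> z" if z: "z \<in> cball 0 1" for z
    unfolding f[OF z] using tendsto_add[OF tendsto_const[of "\<xi> \<bullet> z"] tendsto_mult[OF \<epsilon>(3) lw[OF z]]] by simp
  have lgf: "(\<lambda>n. signed_powr q (f n z)) \<longlonglongrightarrow> signed_powr q (\<xi> \<bullet> z)" if z: "z \<in> cball 0 1" "\<xi> \<bullet> z \<noteq> 0" for z
    by (rule isCont_tendsto_compose[OF isCont_signed_powr lf]) (use z in auto)
  \<comment> \<open>The only difference quotient in the argument. Convexity at its two end points
    gives the bounds \<open>E\<close> below; they provide both the domination and, where \<xi>.z is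
    nonzero, the limit.\<close>
  define E where "E n z = (\<bar>f n z\<bar> powr (q + 1) - \<bar>\<xi> \<bullet> z\<bar> powr (q + 1)) / \<epsilon> n" for n z
  have E: "(q + 1) * signed_powr q (\<xi> \<bullet> z) * w n z \<le> E n z" "E n z \<le> (q + 1) * signed_powr q (f n z) * w n z"
    if z: "z \<in> cball 0 1" for n z
  proof -
    have d: "f n z - \<xi> \<bullet> z = \<epsilon> n * w n z" using f[OF z] by simp
    show "(q + 1) * signed_powr q (\<xi> \<bullet> z) * w n z \<le> E n z"
      using abs_powr_diff_ge[OF q, of "\<xi> \<bullet> z" "f n z"] \<epsilon>(1)[of n]
      unfolding E_def d by (simp add: pos_le_divide_eq mult_ac)
    have "\<xi> \<bullet> z - f n z = - \<epsilon> n * w n z" using d by simp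
    then show "E n z \<le> (q + 1) * signed_powr q (f n z) * w n z"
      using abs_powr_diff_ge[OF q, of "f n z" "\<xi> \<bullet> z"] \<epsilon>(1)[of n]
      unfolding E_def by (simp add: pos_divide_le_eq mult_ac)
  qed
  have cE: "continuous_on (cball 0 1) (E n)" for n
    unfolding E_def using q \<epsilon>(1)[of n] by (intro continuous_intros cf) auto
  have "(\<lambda>n. LINT z|unit_ball_measure. E n z * (\<xi> \<bullet> z)) \<longlonglongrightarrow>
      (LINT z|unit_ball_measure. signed_powr q (\<xi> \<bullet> z) * ((q + 1) * ((\<xi> \<bullet> z) * w0 z)))"
  proof (rule tendsto_integral_ball_bounded)
    show "(\<lambda>z. E n z * (\<xi> \<bullet> z)) \<in> borel_measurable unit_ball_measure" for n
      by (intro measurable_ball_continuous continuous_intros cE)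
    show "(\<lambda>z. signed_powr q (\<xi> \<bullet> z) * ((q + 1) * ((\<xi> \<bullet> z) * w0 z))) \<in> borel_measurable unit_ball_measure"
      by (intro measurable_signed_powr_continuous continuous_intros cw)
    show "\<bar>E n z * (\<xi> \<bullet> z)\<bar> \<le> ((q + 1) * G * C) * A" if "z \<in> ball 0 1" for n z
    proof -
      from that have z: "z \<in> cball 0 1" by simp
      have m: "\<bar>(q + 1) * s * w n z\<bar> \<le> (q + 1) * G * C" if "\<bar>s\<bar> \<le> G" for s
        unfolding abs_mult using that q bw[OF z] C G by (intro mult_mono) auto
      have "\<bar>E n z\<bar> \<le> (q + 1) * G * C"
        using E[OF z, of n] m[OF gf[OF z, of n]] m[OF ga[OF z]] by linarith
      then show ?thesis
        unfolding abs_mult using ba[OF z] q G C by (intro mult_mono) auto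
    qed
    show "AE z in unit_ball_measure. z \<in> ball 0 1 \<longrightarrow>
        (\<lambda>n. E n z * (\<xi> \<bullet> z)) \<longlonglongrightarrow> signed_powr q (\<xi> \<bullet> z) * ((q + 1) * ((\<xi> \<bullet> z) * w0 z))"
      using AE_ball_inner_neq_0[OF \<xi>]
    proof (eventually_elim, intro impI)
      fix z :: 'a assume nz: "\<xi> \<bullet> z \<noteq> 0" and "z \<in> ball 0 1"
      then have z: "z \<in> cball 0 1" by simp
      have "(\<lambda>n. E n z) \<longlonglongrightarrow> (q + 1) * signed_powr q (\<xi> \<bullet> z) * w0 z"
      proof (rule tendsto_sandwich)
        show "\<forall>\<^sub>F n in sequentially. (q + 1) * signed_powr q (\<xi> \<bullet> z) * w n z \<le> E n z"
          "\<forall>\<^sub>F n in sequentially. E n z \<le> (q + 1) * signed_powr q (f n z) * w n z"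
          using E[OF z] by auto
      qed (intro tendsto_intros lw lgf z nz)+
      then have "(\<lambda>n. E n z * (\<xi> \<bullet> z)) \<longlonglongrightarrow> ((q + 1) * signed_powr q (\<xi> \<bullet> z) * w0 z) * (\<xi> \<bullet> z)"
        by (intro tendsto_intros)
      then show "(\<lambda>n. E n z * (\<xi> \<bullet> z)) \<longlonglongrightarrow> signed_powr q (\<xi> \<bullet> z) * ((q + 1) * ((\<xi> \<bullet> z) * w0 z))"
        by (simp add: mult_ac)
    qed
  qed
  also have "(\<lambda>z. signed_powr q (\<xi> \<bullet> z) * ((q + 1) * ((\<xi> \<bullet> z) * w0 z))) =
      (\<lambda>z. (q + 1) * (signed_powr q (\<xi> \<bullet> z) * ((\<xi> \<bullet> z) * w0 z)))"
    by (simp add: fun_eq_iff algebra_simps)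
  finally have T1: "(\<lambda>n. LINT z|unit_ball_measure. E n z * (\<xi> \<bullet> z)) \<longlonglongrightarrow> (q + 1) * ?I"
    by simp
  have T2: "(\<lambda>n. LINT z|unit_ball_measure. signed_powr q (f n z) * ((\<xi> \<bullet> z) * w n z)) \<longlonglongrightarrow> ?I"
  proof (rule tendsto_integral_ball_bounded)
    show "\<bar>signed_powr q (f n z) * ((\<xi> \<bullet> z) * w n z)\<bar> \<le> G * (A * C)" if "z \<in> ball 0 1" for n z
    proof -
      from that have z: "z \<in> cball 0 1" by simp
      have "A \<ge> 0" using C by (simp add: A_def)
      then show ?thesis
        unfolding abs_mult using gf[OF z] ba[OF z] bw[OF z] G C by (intro mult_mono) auto
    qed
    show "AE z in unit_ball_measure. z \<in> ball 0 1 \<longrightarrow>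
        (\<lambda>n. signed_powr q (f n z) * ((\<xi> \<bullet> z) * w n z)) \<longlonglongrightarrow> signed_powr q (\<xi> \<bullet> z) * ((\<xi> \<bullet> z) * w0 z)"
      using AE_ball_inner_neq_0[OF \<xi>]
      by eventually_elim (auto intro!: tendsto_intros lgf lw)
  qed (intro measurable_signed_powr_continuous cf continuous_intros cw)+
  have T3: "(\<lambda>n. LINT z|unit_ball_measure. signed_powr q (f n z) * (dw n z \<bullet> (\<xi> - (\<xi> \<bullet> z) *\<^sub>R z))) \<longlonglongrightarrow> ?J"
  proof (rule tendsto_integral_ball_bounded)
    show "\<bar>signed_powr q (f n z) * (dw n z \<bullet> (\<xi> - (\<xi> \<bullet> z) *\<^sub>R z))\<bar> \<le> G * (C * Y)" if "z \<in> ball 0 1" for n z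
    proof -
      from that have z: "z \<in> cball 0 1" by simp
      have "\<bar>dw n z \<bullet> (\<xi> - (\<xi> \<bullet> z) *\<^sub>R z)\<bar> \<le> norm (dw n z) * norm (\<xi> - (\<xi> \<bullet> z) *\<^sub>R z)"
        by (rule Cauchy_Schwarz_ineq2)
      also have "\<dots> \<le> C * Y" using bdw[OF z] Y(2)[OF z] C by (intro mult_mono) auto
      finally show ?thesis
        unfolding abs_mult[of "signed_powr _ _"] using gf[OF z] G by (intro mult_mono) auto
    qed
    show "AE z in unit_ball_measure. z \<in> ball 0 1 \<longrightarrow>
        (\<lambda>n. signed_powr q (f n z) * (dw n z \<bullet> (\<xi> - (\<xi> \<bullet> z) *\<^sub>R z))) \<longlonglongrightarrow>
        signed_powr q (\<xi> \<bullet> z) * (dw0 z \<bullet> (\<xi> - (\<xi> \<bullet> z) *\<^sub>R z))"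
      using AE_ball_inner_neq_0[OF \<xi>]
      by eventually_elim (auto intro!: tendsto_intros lgf ldw)
  qed (intro measurable_signed_powr_continuous cf continuous_intros cdw)+
  have eq: "integral\<^sup>L unit_ball_measure (\<lambda>z. signed_powr q (f n z)) / \<epsilon> n =
     (((?N + 1) / (q + 1) + 1) * (LINT z|unit_ball_measure. E n z * (\<xi> \<bullet> z))
       - (LINT z|unit_ball_measure. signed_powr q (f n z) * ((\<xi> \<bullet> z) * w n z))
       - (LINT z|unit_ball_measure. signed_powr q (f n z) * (dw n z \<bullet> (\<xi> - (\<xi> \<bullet> z) *\<^sub>R z)))) / (\<xi> \<bullet> \<xi>)" for n
  proof -
    let ?g = "\<lambda>z. signed_powr q (f n z)" and ?Y = "\<lambda>z. \<xi> - (\<xi> \<bullet> z) *\<^sub>R z"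
    note int = integrable_signed_powr_continuous[OF q cf]
    have i: "integrable unit_ball_measure (\<lambda>z. ?g z * (df n z \<bullet> ?Y z))"
      "integrable unit_ball_measure (\<lambda>z. ?g z * (f n z * (\<xi> \<bullet> z)))"
      "integrable unit_ball_measure (\<lambda>z. ?g z * ((\<xi> \<bullet> z) * w n z))"
      "integrable unit_ball_measure (\<lambda>z. ?g z * (dw n z \<bullet> ?Y z))"
      by (intro int continuous_intros cf cdf cw cdw)+
    have pt: "(\<xi> \<bullet> \<xi>) * ?g z = ?g z * (df n z \<bullet> ?Y z) + ?g z * (f n z * (\<xi> \<bullet> z))
        - \<epsilon> n * (?g z * ((\<xi> \<bullet> z) * w n z)) - \<epsilon> n * (?g z * (dw n z \<bullet> ?Y z))" if z: "z \<in> ball 0 1" for z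
    proof -
      have "\<xi> \<bullet> \<xi> = df n z \<bullet> ?Y z + f n z * (\<xi> \<bullet> z) - \<epsilon> n * ((\<xi> \<bullet> z) * w n z) - \<epsilon> n * (dw n z \<bullet> ?Y z)"
        using f[of z n] df[of z n] z by (simp add: algebra_simps)
      then have "(\<xi> \<bullet> \<xi>) * ?g z =
        (df n z \<bullet> ?Y z + f n z * (\<xi> \<bullet> z) - \<epsilon> n * ((\<xi> \<bullet> z) * w n z) - \<epsilon> n * (dw n z \<bullet> ?Y z)) * ?g z"
        by simp
      then show ?thesis by (simp only: algebra_simps)
    qed
    have "(\<xi> \<bullet> \<xi>) * integral\<^sup>L unit_ball_measure ?g = (LINT z|unit_ball_measure. (\<xi> \<bullet> \<xi>) * ?g z)"
      by simp
    also have "\<dots> = (LINT z|unit_ball_measure. ?g z * (df n z \<bullet> ?Y z) + ?g z * (f n z * (\<xi> \<bullet> z))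
        - \<epsilon> n * (?g z * ((\<xi> \<bullet> z) * w n z)) - \<epsilon> n * (?g z * (dw n z \<bullet> ?Y z)))"
      by (rule Bochner_Integration.integral_cong) (use pt in \<open>simp_all add: space_restrict_space\<close>)
    also have "\<dots> = (LINT z|unit_ball_measure. ?g z * (df n z \<bullet> ?Y z))
        + (LINT z|unit_ball_measure. ?g z * (f n z * (\<xi> \<bullet> z)))
        - \<epsilon> n * (LINT z|unit_ball_measure. ?g z * ((\<xi> \<bullet> z) * w n z))
        - \<epsilon> n * (LINT z|unit_ball_measure. ?g z * (dw n z \<bullet> ?Y z))"
      using i by (simp add: integrable_mult_right)
    \<comment> \<open>Here the term with \<nabla>f is integrated by parts; it becomes a multiple of
      the integral of |f|^(q+1) (\<xi>.z), as the next term already is.\<close>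
    also have "(LINT z|unit_ball_measure. ?g z * (df n z \<bullet> ?Y z)) =
        (?N + 1) / (q + 1) * (LINT z|unit_ball_measure. ?g z * (f n z * (\<xi> \<bullet> z)))"
      using integral_tangential_field_signed_powr[OF q der cdf, of n \<xi>] q by (simp add: field_simps)
    also have "(LINT z|unit_ball_measure. ?g z * (f n z * (\<xi> \<bullet> z))) =
        \<epsilon> n * (LINT z|unit_ball_measure. E n z * (\<xi> \<bullet> z))"
    proof -
      have "?g z * (f n z * (\<xi> \<bullet> z)) = \<epsilon> n * (E n z * (\<xi> \<bullet> z)) + \<bar>\<xi> \<bullet> z\<bar> powr (q + 1) * (\<xi> \<bullet> z)" for z
      proof -
        have "?g z * (f n z * (\<xi> \<bullet> z)) = (f n z * ?g z) * (\<xi> \<bullet> z)" by simp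
        also have "\<dots> = \<bar>f n z\<bar> powr (q + 1) * (\<xi> \<bullet> z)" unfolding mult_signed_powr ..
        also have "\<bar>f n z\<bar> powr (q + 1) = \<epsilon> n * E n z + \<bar>\<xi> \<bullet> z\<bar> powr (q + 1)"
          using \<epsilon>(1)[of n] by (simp add: E_def)
        finally show ?thesis by (simp add: algebra_simps)
      qed
      \<comment> \<open>The subtracted |\<xi>.z|^(q+1) (\<xi>.z) is odd, so inserting it costs
        nothing and extracts a factor \<epsilon>.\<close>
      moreover have "(LINT z|unit_ball_measure. \<bar>\<xi> \<bullet> z\<bar> powr (q + 1) * (\<xi> \<bullet> z)) = 0"
        using q by (intro integral_unit_ball_odd measurable_ball_continuous continuous_intros) auto
      moreover have "integrable unit_ball_measure (\<lambda>z. \<bar>\<xi> \<bullet> z\<bar> powr (q + 1) * (\<xi> \<bullet> z))"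
        "integrable unit_ball_measure (\<lambda>z. \<epsilon> n * (E n z * (\<xi> \<bullet> z)))"
        using q by (intro integrable_ball_continuous continuous_intros cE; simp)+
      ultimately show ?thesis by simp
    qed
    finally have *: "(\<xi> \<bullet> \<xi>) * integral\<^sup>L unit_ball_measure ?g =
      (?N + 1) / (q + 1) * (\<epsilon> n * (LINT z|unit_ball_measure. E n z * (\<xi> \<bullet> z))) +
      \<epsilon> n * (LINT z|unit_ball_measure. E n z * (\<xi> \<bullet> z)) -
      \<epsilon> n * (LINT z|unit_ball_measure. ?g z * ((\<xi> \<bullet> z) * w n z)) -
      \<epsilon> n * (LINT z|unit_ball_measure. ?g z * (dw n z \<bullet> ?Y z))" .
    have "I / e = ((c + 1) * P - T - J) / X" if "X * I = c * (e * P) + e * P - e * T - e * J" "X \<noteq> 0" "e \<noteq> 0"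
      for I e c P T J X :: real
      using that by (simp add: frac_eq_eq algebra_simps)
    from this[OF *] show ?thesis using \<xi> \<epsilon>(1)[of n] by simp
  qed
  have "(\<lambda>n. integral\<^sup>L unit_ball_measure (\<lambda>z. signed_powr q (f n z)) / \<epsilon> n) \<longlonglongrightarrow>
     (((?N + 1) / (q + 1) + 1) * ((q + 1) * ?I) - ?I - ?J) / (\<xi> \<bullet> \<xi>)"
    unfolding eq using \<xi> by (intro tendsto_intros T1 T2 T3) auto
  \<comment> \<open>Origin of N + q + 1: N + 1 from the divergence of the tangential field, q + 1
    from f (\<xi>.z), and -1 from the correction a = f - \<epsilon> w.\<close>
  also have "((?N + 1) / (q + 1) + 1) * ((q + 1) * ?I) - ?I - ?J = (?N + q + 1) * ?I - ?J"
    using q by (simp add: field_simps)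
  finally show ?thesis .
qed

section \<open>Linear and quadratic moments weighted by signed powers\<close>

lemma integral_signed_powr_mult_orthogonal:
  fixes \<xi> b :: "'a::euclidean_space"
  assumes q: "q \<ge> 0" and orth: "\<xi> \<bullet> b = 0"
  shows "(LINT z|unit_ball_measure. signed_powr q (\<xi> \<bullet> z) * ((1 - z \<bullet> z) ^ j * (b \<bullet> z))) = 0"
proof -
  \<comment> \<open>Along \<open>b\<close> the value \<xi>.z is constant, so only the power of 1 -
    |z|^2 is differentiated and \<open>q = 0\<close> is covered directly. The exponent j + 1 is at
    least 1, which ensures linear decay at the sphere even for \<open>j = 0\<close>.\<close>
  define \<phi> where "\<phi> z = indicator (ball 0 1) z *\<^sub>R (signed_powr q (\<xi> \<bullet> z) * (1 - z \<bullet> z) ^ Suc j)" for z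
  define D where "D z = - 2 * real (Suc j) * (signed_powr q (\<xi> \<bullet> z) * ((1 - z \<bullet> z) ^ j * (b \<bullet> z)))" for z
  define G where "G = norm \<xi> powr q"
  define L where "L = 2 * real (Suc j) * G * (1 + norm b)"
  have G: "G \<ge> 0" by (simp add: G_def)
  have g: "\<bar>signed_powr q (\<xi> \<bullet> z)\<bar> \<le> G" if "z \<in> ball 0 1" for z
    unfolding G_def
  proof (rule abs_signed_powr_le[OF q])
    show "\<bar>\<xi> \<bullet> z\<bar> \<le> norm \<xi>"
      using that Cauchy_Schwarz_ineq2[of \<xi> z] mult_left_mono[of "norm z" 1 "norm \<xi>"] by simp
  qed
  have zz: "0 \<le> 1 - z \<bullet> z" "1 - z \<bullet> z \<le> 1" "1 - z \<bullet> z \<le> 2 * (1 - norm z)" if "z \<in> ball 0 1" for z :: 'a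
    using that one_minus_power_le[of "norm z" 2]
    by (auto simp: dot_square_norm power_le_one)
  have "integral\<^sup>L unit_ball_measure D = 0"
  proof (rule integral_directional_derivative_eq_0[where \<phi>=\<phi> and v=b and L=L])
    have "(\<lambda>z. signed_powr q (\<xi> \<bullet> z) * (1 - z \<bullet> z) ^ Suc j) \<in> borel_measurable unit_ball_measure"
      by (intro measurable_signed_powr_continuous continuous_intros)
    then show "\<phi> \<in> borel_measurable lebesgue"
      unfolding \<phi>_def by (subst (asm) borel_measurable_restrict_space_iff) auto
    show "D \<in> borel_measurable unit_ball_measure"
      unfolding D_def
      by (intro borel_measurable_times borel_measurable_const measurable_signed_powr_continuous continuous_intros)
    show "\<phi> z = 0" if "z \<notin> ball 0 1" for z using that by (simp add: \<phi>_def)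
    show "\<bar>D z\<bar> \<le> L" if z: "z \<in> ball 0 1" for z
    proof -
      have "\<bar>b \<bullet> z\<bar> \<le> 1 + norm b"
        using z Cauchy_Schwarz_ineq2[of b z] mult_left_mono[of "norm z" 1 "norm b"] by simp
      moreover have "\<bar>(1 - z \<bullet> z) ^ j\<bar> \<le> 1"
        using zz[OF z] by (simp add: power_le_one power_abs)
      ultimately have "\<bar>signed_powr q (\<xi> \<bullet> z) * ((1 - z \<bullet> z) ^ j * (b \<bullet> z))\<bar> \<le> G * (1 * (1 + norm b))"
        unfolding abs_mult using g[OF z] G by (intro mult_mono) auto
      then have "2 * real (Suc j) * \<bar>signed_powr q (\<xi> \<bullet> z) * ((1 - z \<bullet> z) ^ j * (b \<bullet> z))\<bar> \<le>
          2 * real (Suc j) * (G * (1 * (1 + norm b)))"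
        by (intro mult_left_mono) auto
      moreover have "\<bar>D z\<bar> = 2 * real (Suc j) * \<bar>signed_powr q (\<xi> \<bullet> z) * ((1 - z \<bullet> z) ^ j * (b \<bullet> z))\<bar>"
        unfolding D_def abs_mult by simp
      ultimately show ?thesis unfolding L_def by (simp only: mult_1_left mult.assoc)
    qed
    show "\<bar>\<phi> z\<bar> \<le> L * (1 - norm z)" if z: "z \<in> ball 0 1" for z
    proof -
      have nz: "norm z < 1" using z by simp
      have "\<bar>(1 - z \<bullet> z) ^ Suc j\<bar> \<le> 2 * (1 - norm z)"
      proof -
        have "(1 - z \<bullet> z) ^ Suc j \<le> (1 - z \<bullet> z) ^ 1"
          using zz[OF z] by (intro power_decreasing) auto
        moreover have "0 \<le> (1 - z \<bullet> z) ^ Suc j" using zz[OF z] by simp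
        ultimately show ?thesis using zz[OF z] by simp
      qed
      then have "\<bar>signed_powr q (\<xi> \<bullet> z) * (1 - z \<bullet> z) ^ Suc j\<bar> \<le> G * (2 * (1 - norm z))"
        unfolding abs_mult using g[OF z] G by (intro mult_mono) auto
      also have "\<dots> = (2 * G) * (1 - norm z)" by simp
      also have "\<dots> \<le> L * (1 - norm z)"
      proof (rule mult_right_mono)
        have "2 * G * (1 * 1) \<le> 2 * G * (real (Suc j) * (1 + norm b))"
          using G by (intro mult_left_mono mult_mono) auto
        moreover have "L = 2 * G * (real (Suc j) * (1 + norm b))" unfolding L_def by (simp only: mult_ac)
        ultimately show "2 * G \<le> L" by (simp only: mult_1_right)
      qed (use nz in simp)
      finally show ?thesis using z by (simp add: \<phi>_def)
    qed
    show "((\<lambda>t. \<phi> (z + t *\<^sub>R b)) has_real_derivative D z) (at 0)" if z: "z \<in> ball 0 1" for z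
    proof (rule has_field_derivative_transform_within_open)
      have "((\<lambda>z. 1 - z \<bullet> z) has_derivative (\<lambda>h. - 2 * (z \<bullet> h))) (at z)"
        by (auto intro!: derivative_eq_intros simp: inner_commute)
      from has_real_derivative_along_line[OF this, of b]
      have "((\<lambda>t. 1 - (z + t *\<^sub>R b) \<bullet> (z + t *\<^sub>R b)) has_real_derivative - 2 * (z \<bullet> b)) (at 0)" .
      from DERIV_cmult[OF DERIV_power[OF this, of "Suc j"], of "signed_powr q (\<xi> \<bullet> z)"]
      show "((\<lambda>t. signed_powr q (\<xi> \<bullet> z) * (1 - (z + t *\<^sub>R b) \<bullet> (z + t *\<^sub>R b)) ^ Suc j) has_real_derivative D z) (at 0)"
        by (rule DERIV_cong) (simp add: D_def inner_commute algebra_simps)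
      show "open ((\<lambda>t. z + t *\<^sub>R b) -` ball 0 1)"
        by (intro open_vimage continuous_intros) auto
    qed (use z orth in \<open>auto simp: \<phi>_def inner_add_right\<close>)
  qed
  then show ?thesis unfolding D_def by (simp del: of_nat_Suc)
qed

text \<open>\<open>b\<close> splits into its projection onto \<xi> and an orthogonal rest, whose
  moment is zero.\<close>

lemma integral_signed_powr_mult_inner:
  fixes \<xi> b :: "'a::euclidean_space"
  assumes q: "q \<ge> 0" and \<xi>: "\<xi> \<noteq> 0"
  shows "(LINT z|unit_ball_measure. signed_powr q (\<xi> \<bullet> z) * ((1 - z \<bullet> z) ^ j * (b \<bullet> z))) =
    (\<xi> \<bullet> b) / (\<xi> \<bullet> \<xi>) * (LINT z|unit_ball_measure. signed_powr q (\<xi> \<bullet> z) * ((1 - z \<bullet> z) ^ j * (\<xi> \<bullet> z)))"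
proof -
  define c where "c = (\<xi> \<bullet> b) / (\<xi> \<bullet> \<xi>)"
  have "\<xi> \<bullet> (b - c *\<^sub>R \<xi>) = 0" using \<xi> by (simp add: c_def inner_diff_right)
  from integral_signed_powr_mult_orthogonal[OF q this, of j]
  have "0 = (LINT z|unit_ball_measure. signed_powr q (\<xi> \<bullet> z) * ((1 - z \<bullet> z) ^ j * ((b - c *\<^sub>R \<xi>) \<bullet> z)))" by simp
  also have "\<dots> = (LINT z|unit_ball_measure. signed_powr q (\<xi> \<bullet> z) * ((1 - z \<bullet> z) ^ j * (b \<bullet> z)) -
      c * (signed_powr q (\<xi> \<bullet> z) * ((1 - z \<bullet> z) ^ j * (\<xi> \<bullet> z))))"
    by (simp add: inner_diff_left algebra_simps)
  also have "\<dots> = (LINT z|unit_ball_measure. signed_powr q (\<xi> \<bullet> z) * ((1 - z \<bullet> z) ^ j * (b \<bullet> z))) -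
      c * (LINT z|unit_ball_measure. signed_powr q (\<xi> \<bullet> z) * ((1 - z \<bullet> z) ^ j * (\<xi> \<bullet> z)))"
    by (subst Bochner_Integration.integral_diff)
      (auto intro!: integrable_mult_right integrable_signed_powr_continuous continuous_intros q)
  finally show ?thesis by (simp add: c_def)
qed

text \<open>The divergence identity with weight 1 - |z|^2, applied to |\<xi>.z|^(q+1) A z, relates a
  quadratic moment to one scalar \<open>S\<close> that does not depend on A. Taking A = H and A =
  identity and eliminating \<open>S\<close> gives the formula.\<close>

lemma integral_signed_powr_mult_quadratic:
  fixes \<xi> :: "'a::euclidean_space" and H :: "'a \<Rightarrow> 'a"
  assumes q: "q \<ge> 0" and \<xi>: "\<xi> \<noteq> 0" and H: "linear H"
  shows "(real DIM('a) + q + 3) * (LINT z|unit_ball_measure. signed_powr q (\<xi> \<bullet> z) * ((\<xi> \<bullet> z) * (H z \<bullet> z))) =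
    ((\<Sum>b\<in>Basis. H b \<bullet> b) + (q + 1) * (H \<xi> \<bullet> \<xi>) / (\<xi> \<bullet> \<xi>)) *
      (LINT z|unit_ball_measure. signed_powr q (\<xi> \<bullet> z) * (\<xi> \<bullet> z))"
proof -
  have cont: "continuous_on S A" if "linear A" for A :: "'a \<Rightarrow> 'a" and S
    using that by (simp add: linear_continuous_on linear_conv_bounded_linear)
  have pos: "(real DIM('a) + r + 3) * (LINT z|unit_ball_measure. signed_powr r (\<xi> \<bullet> z) * ((\<xi> \<bullet> z) * (H z \<bullet> z))) =
    ((\<Sum>b\<in>Basis. H b \<bullet> b) + (r + 1) * (H \<xi> \<bullet> \<xi>) / (\<xi> \<bullet> \<xi>)) *
      (LINT z|unit_ball_measure. signed_powr r (\<xi> \<bullet> z) * (\<xi> \<bullet> z))" if r: "r > 0" for r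
  proof -
    define S where "S = (LINT z|unit_ball_measure. signed_powr r (\<xi> \<bullet> z) * ((1 - z \<bullet> z) ^ 1 * (\<xi> \<bullet> z)))"
    note int = integrable_signed_powr_continuous[of r]
    have gen: "((\<Sum>b\<in>Basis. A b \<bullet> b) + (r + 1) * (A \<xi> \<bullet> \<xi>) / (\<xi> \<bullet> \<xi>)) * S =
        2 * (LINT z|unit_ball_measure. signed_powr r (\<xi> \<bullet> z) * ((\<xi> \<bullet> z) * (A z \<bullet> z)))"
      if A: "linear A" for A :: "'a \<Rightarrow> 'a"
    proof -
      note cA = cont[OF A]
      define t where "t = (\<Sum>b\<in>Basis. A b \<bullet> b)"
      define U where "U z = (\<bar>\<xi> \<bullet> z\<bar> powr (r + 1)) *\<^sub>R A z" for z
      define U' where "U' z h = ((r + 1) * signed_powr r (\<xi> \<bullet> z) * (\<xi> \<bullet> h)) *\<^sub>R A z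
          + (\<bar>\<xi> \<bullet> z\<bar> powr (r + 1)) *\<^sub>R A h" for z h
      have "(LINT z|unit_ball_measure. (1 - (z \<bullet> z) ^ Suc 0) * (\<Sum>b\<in>Basis. U' z b \<bullet> b)) =
        (LINT z|unit_ball_measure. 2 * real (Suc 0) * (z \<bullet> z) ^ 0 * (U z \<bullet> z))"
      proof (rule integral_weighted_divergence)
        fix z :: 'a
        have "((\<lambda>z. \<xi> \<bullet> z) has_derivative (\<lambda>h. \<xi> \<bullet> h)) (at z)"
          by (auto intro!: derivative_eq_intros)
        then have "((\<lambda>z. \<bar>\<xi> \<bullet> z\<bar> powr (r + 1)) has_derivative (\<lambda>h. (r + 1) * signed_powr r (\<xi> \<bullet> z) * (\<xi> \<bullet> h))) (at z)"
          by (rule has_derivative_compose[OF _ has_real_derivative_abs_powr[OF r, unfolded has_field_derivative_def]])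
        moreover have "(A has_derivative A) (at z)"
          using A by (simp add: linear_conv_bounded_linear bounded_linear_imp_has_derivative)
        ultimately show "(U has_derivative U' z) (at z)"
          unfolding U_def
          by (rule has_derivative_eq_rhs[OF has_derivative_scaleR]) (simp add: fun_eq_iff U'_def)
        show "continuous_on (cball 0 1) (\<lambda>z. U' z b)" for b
          unfolding U'_def using r by (intro continuous_intros continuous_on_signed_powr cA) auto
      qed
      also have "(\<lambda>z. 2 * real (Suc 0) * (z \<bullet> z) ^ 0 * (U z \<bullet> z)) =
          (\<lambda>z. 2 * (signed_powr r (\<xi> \<bullet> z) * ((\<xi> \<bullet> z) * (A z \<bullet> z))))"
        unfolding U_def mult_signed_powr[symmetric] by (simp add: fun_eq_iff mult_ac)
      also have "(LINT z|unit_ball_measure. 2 * (signed_powr r (\<xi> \<bullet> z) * ((\<xi> \<bullet> z) * (A z \<bullet> z)))) =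
          2 * (LINT z|unit_ball_measure. signed_powr r (\<xi> \<bullet> z) * ((\<xi> \<bullet> z) * (A z \<bullet> z)))"
        by simp
      also have "(\<lambda>z. (1 - (z \<bullet> z) ^ Suc 0) * (\<Sum>b\<in>Basis. U' z b \<bullet> b)) = (\<lambda>z.
          (r + 1) * (signed_powr r (\<xi> \<bullet> z) * ((1 - z \<bullet> z) ^ 1 * (adjoint A \<xi> \<bullet> z))) +
          t * (signed_powr r (\<xi> \<bullet> z) * ((1 - z \<bullet> z) ^ 1 * (\<xi> \<bullet> z))))"
      proof (rule ext)
        fix z
        have "(\<Sum>b\<in>Basis. U' z b \<bullet> b) = (r + 1) * signed_powr r (\<xi> \<bullet> z) * (\<Sum>b\<in>Basis. (\<xi> \<bullet> b) * (A z \<bullet> b)) +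
          \<bar>\<xi> \<bullet> z\<bar> powr (r + 1) * t"
          unfolding U'_def t_def
          by (simp only: inner_add_left inner_scaleR_left sum.distrib sum_distrib_left mult.assoc)
        also have "(\<Sum>b\<in>Basis. (\<xi> \<bullet> b) * (A z \<bullet> b)) = adjoint A \<xi> \<bullet> z"
          unfolding euclidean_inner[symmetric] using adjoint_works[OF A, of z \<xi>] by (simp add: inner_commute)
        finally show "(1 - (z \<bullet> z) ^ Suc 0) * (\<Sum>b\<in>Basis. U' z b \<bullet> b) =
          (r + 1) * (signed_powr r (\<xi> \<bullet> z) * ((1 - z \<bullet> z) ^ 1 * (adjoint A \<xi> \<bullet> z))) +
          t * (signed_powr r (\<xi> \<bullet> z) * ((1 - z \<bullet> z) ^ 1 * (\<xi> \<bullet> z)))"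
          unfolding mult_signed_powr[symmetric] by (simp add: algebra_simps)
      qed
      also have "(LINT z|unit_ball_measure.
          (r + 1) * (signed_powr r (\<xi> \<bullet> z) * ((1 - z \<bullet> z) ^ 1 * (adjoint A \<xi> \<bullet> z))) +
          t * (signed_powr r (\<xi> \<bullet> z) * ((1 - z \<bullet> z) ^ 1 * (\<xi> \<bullet> z)))) =
          (r + 1) * (LINT z|unit_ball_measure. signed_powr r (\<xi> \<bullet> z) * ((1 - z \<bullet> z) ^ 1 * (adjoint A \<xi> \<bullet> z)))
          + t * S"
        unfolding S_def using r
        by (subst Bochner_Integration.integral_add)
          (auto intro!: integrable_mult_right int continuous_intros)
      \<comment> \<open>The adjoint presents \<xi>.(A z) as a linear functional of z, so the linear
        moment formula leaves only the component (A \<xi>).\<xi>.\<close>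
      also have "(LINT z|unit_ball_measure. signed_powr r (\<xi> \<bullet> z) * ((1 - z \<bullet> z) ^ 1 * (adjoint A \<xi> \<bullet> z))) =
          (\<xi> \<bullet> adjoint A \<xi>) / (\<xi> \<bullet> \<xi>) * S"
        unfolding S_def using r \<xi> by (intro integral_signed_powr_mult_inner) auto
      also have "\<xi> \<bullet> adjoint A \<xi> = A \<xi> \<bullet> \<xi>" by (rule adjoint_works[OF A])
      finally show ?thesis unfolding t_def by (simp add: algebra_simps)
    qed
    define P where "P = (LINT z|unit_ball_measure. signed_powr r (\<xi> \<bullet> z) * (\<xi> \<bullet> z))"
    \<comment> \<open>For the identity map the trace is N and the quotient is 1; since |z|^2 = 1 -
      (1 - |z|^2), the moment is P - S, which determines S.\<close>
    have "(real DIM('a) + (r + 1)) * S =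
        2 * (LINT z|unit_ball_measure. signed_powr r (\<xi> \<bullet> z) * ((\<xi> \<bullet> z) * (z \<bullet> z)))"
    proof -
      have "linear (\<lambda>z::'a. z)" by (rule linear_id[unfolded id_def])
      moreover have "(\<Sum>b\<in>(Basis::'a set). b \<bullet> b) = real DIM('a)" by (simp add: inner_Basis)
      ultimately show ?thesis using gen[of "\<lambda>z. z"] \<xi> by simp
    qed
    also have "(LINT z|unit_ball_measure. signed_powr r (\<xi> \<bullet> z) * ((\<xi> \<bullet> z) * (z \<bullet> z))) =
        (LINT z|unit_ball_measure. signed_powr r (\<xi> \<bullet> z) * (\<xi> \<bullet> z)
          - signed_powr r (\<xi> \<bullet> z) * ((1 - z \<bullet> z) ^ 1 * (\<xi> \<bullet> z)))"
      by (simp add: algebra_simps)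
    also have "\<dots> = P - S"
      unfolding P_def S_def using r
      by (subst Bochner_Integration.integral_diff) (auto intro!: int continuous_intros)
    finally have S: "(real DIM('a) + r + 3) * S = 2 * P" by (simp add: algebra_simps)
    have "M * Q = T * P" if "T * S = 2 * Q" "M * S = 2 * P" for M Q T
    proof -
      have "2 * (M * Q) = M * (T * S)" unfolding that(1) by simp
      also have "\<dots> = T * (M * S)" by simp
      also have "\<dots> = 2 * (T * P)" unfolding that(2) by simp
      finally show ?thesis by simp
    qed
    from this[OF gen[OF H] S] show ?thesis unfolding P_def .
  qed
  show ?thesis
  proof (cases "q = 0")
    case False
    with q have "q > 0" by simp
    then show ?thesis by (rule pos)
  next
    case True
    have 1: "(\<lambda>n. (real DIM('a) + 1 / real (Suc n) + 3) *
        (LINT z|unit_ball_measure. signed_powr (1 / real (Suc n)) (\<xi> \<bullet> z) * ((\<xi> \<bullet> z) * (H z \<bullet> z))))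
      \<longlonglongrightarrow> (real DIM('a) + 0 + 3) * (LINT z|unit_ball_measure. signed_powr 0 (\<xi> \<bullet> z) * ((\<xi> \<bullet> z) * (H z \<bullet> z)))"
      by (intro tendsto_mult tendsto_add tendsto_const lim_1_over_n[THEN LIMSEQ_Suc]
        tendsto_integral_signed_powr continuous_intros cont[OF H])
    have 2: "(\<lambda>n. ((\<Sum>b\<in>Basis. H b \<bullet> b) + (1 / real (Suc n) + 1) * (H \<xi> \<bullet> \<xi>) / (\<xi> \<bullet> \<xi>)) *
      (LINT z|unit_ball_measure. signed_powr (1 / real (Suc n)) (\<xi> \<bullet> z) * (\<xi> \<bullet> z)))
      \<longlonglongrightarrow> ((\<Sum>b\<in>Basis. H b \<bullet> b) + (0 + 1) * (H \<xi> \<bullet> \<xi>) / (\<xi> \<bullet> \<xi>)) *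
        (LINT z|unit_ball_measure. signed_powr 0 (\<xi> \<bullet> z) * (\<xi> \<bullet> z))"
      using \<xi> by (intro tendsto_mult tendsto_add tendsto_divide tendsto_const lim_1_over_n[THEN LIMSEQ_Suc]
        tendsto_integral_signed_powr continuous_intros) auto
    have 3: "(\<lambda>n. (real DIM('a) + 1 / real (Suc n) + 3) *
        (LINT z|unit_ball_measure. signed_powr (1 / real (Suc n)) (\<xi> \<bullet> z) * ((\<xi> \<bullet> z) * (H z \<bullet> z)))) =
      (\<lambda>n. ((\<Sum>b\<in>Basis. H b \<bullet> b) + (1 / real (Suc n) + 1) * (H \<xi> \<bullet> \<xi>) / (\<xi> \<bullet> \<xi>)) *
      (LINT z|unit_ball_measure. signed_powr (1 / real (Suc n)) (\<xi> \<bullet> z) * (\<xi> \<bullet> z)))"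
      by (intro ext pos) simp
    show ?thesis
      unfolding True by (rule LIMSEQ_unique[OF 1 2[folded 3]])
  qed
qed

text \<open>The integrand equals |\<xi>.z|^(q+1), positive off a null set. Strict positivity makes
  the limit of the first variation strictly decreasing in k.\<close>

lemma integral_signed_powr_mult_self_pos:
  fixes \<xi> :: "'a::euclidean_space"
  assumes q: "q \<ge> 0" and \<xi>: "\<xi> \<noteq> 0"
  shows "(LINT z|unit_ball_measure. signed_powr q (\<xi> \<bullet> z) * (\<xi> \<bullet> z)) > 0"
proof -
  have eq: "signed_powr q (\<xi> \<bullet> z) * (\<xi> \<bullet> z) = \<bar>\<xi> \<bullet> z\<bar> powr (q + 1)" for z
    using mult_signed_powr[of "\<xi> \<bullet> z" q] by (simp add: mult.commute)
  have int: "integrable unit_ball_measure (\<lambda>z. signed_powr q (\<xi> \<bullet> z) * (\<xi> \<bullet> z))"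
    by (intro integrable_signed_powr_continuous q continuous_intros)
  have "(LINT z|unit_ball_measure. signed_powr q (\<xi> \<bullet> z) * (\<xi> \<bullet> z)) \<noteq> 0"
  proof
    assume "(LINT z|unit_ball_measure. signed_powr q (\<xi> \<bullet> z) * (\<xi> \<bullet> z)) = 0"
    then have "AE z in unit_ball_measure. signed_powr q (\<xi> \<bullet> z) * (\<xi> \<bullet> z) = 0"
      using integral_nonneg_eq_0_iff_AE[OF int] unfolding eq by simp
    then have "AE z in unit_ball_measure. \<not> z \<in> ball (0::'a) 1"
      using AE_ball_inner_neq_0[OF \<xi>] unfolding eq by eventually_elim auto
    then have "AE z in lebesgue. z \<notin> ball (0::'a) 1"
      by (subst (asm) AE_restrict_space_iff) auto
    then have "ball (0::'a) 1 \<in> null_sets lebesgue"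
      by (subst AE_iff_null_sets) auto
    then have "emeasure lebesgue (ball (0::'a) 1) = 0" by blast
    then show False using emeasure_lborel_ball_finite content_ball_pos[of 1 "0::'a"]
      by (simp add: measure_def)
  qed
  moreover have "(LINT z|unit_ball_measure. signed_powr q (\<xi> \<bullet> z) * (\<xi> \<bullet> z)) \<ge> 0"
    unfolding eq by (intro Bochner_Integration.integral_nonneg) auto
  ultimately show ?thesis by linarith
qed

text \<open>With \<open>p = q + 1\<close>, the right-hand side below vanishes exactly at
  \<open>k = (tr H + (p - 2) \<langle>H \<xi>, \<xi>\<rangle> / |\<xi>|\<^sup>2) / (2 (N + p))\<close>.\<close>

lemma integral_first_variation_eq:
  fixes \<xi> :: "'a::euclidean_space" and H :: "'a \<Rightarrow> 'a"
  assumes q: "q \<ge> 0" and \<xi>: "\<xi> \<noteq> 0" and H: "linear H"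
  shows "((real DIM('a) + q + 1) * (LINT z|unit_ball_measure. signed_powr q (\<xi> \<bullet> z) * ((\<xi> \<bullet> z) * (1/2 * (H z \<bullet> z) - k)))
     - (LINT z|unit_ball_measure. signed_powr q (\<xi> \<bullet> z) * (H z \<bullet> (\<xi> - (\<xi> \<bullet> z) *\<^sub>R z)))) / (\<xi> \<bullet> \<xi>) =
    (LINT z|unit_ball_measure. signed_powr q (\<xi> \<bullet> z) * (\<xi> \<bullet> z)) / (\<xi> \<bullet> \<xi>) *
     (1/2 * ((\<Sum>b\<in>Basis. H b \<bullet> b) + (q - 1) * (H \<xi> \<bullet> \<xi>) / (\<xi> \<bullet> \<xi>)) - k * (real DIM('a) + q + 1))"
proof -
  define P where "P = (LINT z|unit_ball_measure. signed_powr q (\<xi> \<bullet> z) * (\<xi> \<bullet> z))"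
  define Q where "Q = (LINT z|unit_ball_measure. signed_powr q (\<xi> \<bullet> z) * ((\<xi> \<bullet> z) * (H z \<bullet> z)))"
  define s where "s = (H \<xi> \<bullet> \<xi>) / (\<xi> \<bullet> \<xi>)"
  define t where "t = (\<Sum>b\<in>Basis. H b \<bullet> b)"
  define M where "M = real DIM('a) + q + 1"
  note int = integrable_signed_powr_continuous[OF q]
  have cH: "continuous_on S H" for S
    using H by (simp add: linear_continuous_on linear_conv_bounded_linear)
  have i: "integrable unit_ball_measure (\<lambda>z. signed_powr q (\<xi> \<bullet> z) * (\<xi> \<bullet> z))"
    "integrable unit_ball_measure (\<lambda>z. signed_powr q (\<xi> \<bullet> z) * ((\<xi> \<bullet> z) * (H z \<bullet> z)))"
    "integrable unit_ball_measure (\<lambda>z. signed_powr q (\<xi> \<bullet> z) * (H z \<bullet> \<xi>))"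
    by (intro int continuous_intros cH)+
  have Q: "(M + 2) * Q = (t + (q + 1) * s) * P"
    using integral_signed_powr_mult_quadratic[OF q \<xi> H] unfolding Q_def P_def t_def s_def M_def by (simp add: add_ac)
  have "(LINT z|unit_ball_measure. signed_powr q (\<xi> \<bullet> z) * ((\<xi> \<bullet> z) * (1/2 * (H z \<bullet> z) - k))) =
    (LINT z|unit_ball_measure. 1/2 * (signed_powr q (\<xi> \<bullet> z) * ((\<xi> \<bullet> z) * (H z \<bullet> z))) - k * (signed_powr q (\<xi> \<bullet> z) * (\<xi> \<bullet> z)))"
    by (simp add: algebra_simps)
  also have "\<dots> = 1/2 * Q - k * P"
    unfolding Q_def P_def using i by (subst Bochner_Integration.integral_diff) (auto intro!: integrable_mult_right)
  finally have 1: "(LINT z|unit_ball_measure. signed_powr q (\<xi> \<bullet> z) * ((\<xi> \<bullet> z) * (1/2 * (H z \<bullet> z) - k))) = 1/2 * Q - k * P" .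
  \<comment> \<open>Linear moment with the adjoint once more, now with weight exponent
    \<open>j = 0\<close>.\<close>
  have "(LINT z|unit_ball_measure. signed_powr q (\<xi> \<bullet> z) * (H z \<bullet> \<xi>)) =
      (LINT z|unit_ball_measure. signed_powr q (\<xi> \<bullet> z) * ((1 - z \<bullet> z) ^ 0 * (adjoint H \<xi> \<bullet> z)))"
    using adjoint_works[OF H, of _ \<xi>] by (simp add: inner_commute)
  also have "\<dots> = (\<xi> \<bullet> adjoint H \<xi>) / (\<xi> \<bullet> \<xi>) * P"
    using integral_signed_powr_mult_inner[OF q \<xi>, of 0 "adjoint H \<xi>"] by (simp add: P_def)
  also have "\<dots> = s * P" unfolding s_def adjoint_works[OF H] ..
  finally have R: "(LINT z|unit_ball_measure. signed_powr q (\<xi> \<bullet> z) * (H z \<bullet> \<xi>)) = s * P" .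
  have "(LINT z|unit_ball_measure. signed_powr q (\<xi> \<bullet> z) * (H z \<bullet> (\<xi> - (\<xi> \<bullet> z) *\<^sub>R z))) =
      (LINT z|unit_ball_measure. signed_powr q (\<xi> \<bullet> z) * (H z \<bullet> \<xi>) - signed_powr q (\<xi> \<bullet> z) * ((\<xi> \<bullet> z) * (H z \<bullet> z)))"
    by (simp add: algebra_simps)
  also have "\<dots> = s * P - Q"
    unfolding R[symmetric] Q_def using i by (intro Bochner_Integration.integral_diff)
  finally have 2: "(LINT z|unit_ball_measure. signed_powr q (\<xi> \<bullet> z) * (H z \<bullet> (\<xi> - (\<xi> \<bullet> z) *\<^sub>R z))) = s * P - Q" .
  \<comment> \<open>\<open>Q\<close> collects the coefficient (M + 2)/2, exactly what the moment
    identity evaluates. The p - 2 of the p-Laplacian appears here: (q+1)s/2 - s = (q-1)s/2.\<close>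
  have "M * (1/2 * Q - k * P) - (s * P - Q) = 1/2 * ((M + 2) * Q) - k * M * P - s * P"
    by (simp add: algebra_simps)
  also have "\<dots> = P * (1/2 * (t + (q - 1) * s) - k * M)"
    unfolding Q by (simp add: algebra_simps)
  finally show ?thesis
    unfolding 1 2 P_def[symmetric] t_def[symmetric] M_def[symmetric] by (simp add: s_def)
qed

section \<open>Expansion of a twice continuously differentiable function\<close>

lemma C2_on_has_derivative:
  assumes "C2_on S u" "y \<in> S"
  shows "(u has_derivative (\<lambda>h. grad u y \<bullet> h)) (at y)"
  using GDERIV_grad[of u y] assms by (simp add: C2_on_def gderiv_def inner_commute)

lemma C2_on_continuous_on: "C2_on S u \<Longrightarrow> continuous_on S u"
  by (auto simp: C2_on_def intro!: continuous_at_imp_continuous_on differentiable_imp_continuous_within)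

lemma C2_on_continuous_on_grad: "C2_on S u \<Longrightarrow> continuous_on S (grad u)"
  by (auto simp: C2_on_def intro!: continuous_at_imp_continuous_on differentiable_imp_continuous_within)

lemma C2_on_has_derivative_grad:
  "C2_on S u \<Longrightarrow> y \<in> S \<Longrightarrow> (grad u has_derivative hessian u y) (at y)"
  by (simp add: C2_on_def hessian_def flip: frechet_derivative_works)

text \<open>Differentiability of the gradient at \<open>x\<close> controls the gradient error
  linearly, and the mean value inequality along the ray carries this over to \<open>u\<close>. Both
  estimates are uniform in z, as the rescaled remainder and its gradient must be bounded
  together.\<close>

lemma second_order_expansion:
  assumes S: "open S" "x \<in> S" and u: "C2_on S u" and \<delta>: "\<delta> > 0"
  obtains r where "r > 0" "cball x r \<subseteq> S"
    "\<And>\<epsilon> z. 0 < \<epsilon> \<Longrightarrow> \<epsilon> \<le> r \<Longrightarrow> z \<in> cball 0 1 \<Longrightarrow>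
       norm (grad u (x + \<epsilon> *\<^sub>R z) - grad u x - \<epsilon> *\<^sub>R hessian u x z) \<le> \<delta> * \<epsilon>"
    "\<And>\<epsilon> z. 0 < \<epsilon> \<Longrightarrow> \<epsilon> \<le> r \<Longrightarrow> z \<in> cball 0 1 \<Longrightarrow>
       \<bar>u (x + \<epsilon> *\<^sub>R z) - u x - \<epsilon> * (grad u x \<bullet> z) - \<epsilon>\<^sup>2 * (1/2 * (hessian u x z \<bullet> z))\<bar> \<le> \<delta> * \<epsilon>\<^sup>2"
proof -
  let ?H = "hessian u x" and ?\<xi> = "grad u x"
  have dH: "(grad u has_derivative ?H) (at x)"
    using C2_on_has_derivative_grad[OF u S(2)] .
  have lin: "linear ?H" using dH has_derivative_linear by blast
  obtain r1 where r1: "r1 > 0" "\<And>y. norm (y - x) < r1 \<Longrightarrow>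
      norm (grad u y - grad u x - ?H (y - x)) \<le> \<delta> * norm (y - x)"
    using dH \<delta> unfolding has_derivative_at_alt by blast
  obtain r2 where r2: "r2 > 0" "cball x r2 \<subseteq> S"
    using S open_contains_cball by blast
  \<comment> \<open>Half of \<open>r1\<close>, because the differentiability estimate holds only for
    distances strictly below \<open>r1\<close>.\<close>
  define r where "r = min (r1 / 2) r2"
  have r: "r > 0" "r < r1" "cball x r \<subseteq> S" using r1 r2 by (auto simp: r_def)
  have g: "norm (grad u (x + \<epsilon> *\<^sub>R z) - ?\<xi> - \<epsilon> *\<^sub>R ?H z) \<le> \<delta> * \<epsilon>"
    if "0 \<le> \<epsilon>" "\<epsilon> \<le> r" "z \<in> cball 0 1" for \<epsilon> z
  proof -
    have n: "norm (\<epsilon> *\<^sub>R z) \<le> \<epsilon>" using that mult_left_mono[of "norm z" 1 \<epsilon>] by simp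
    then have "norm (grad u (x + \<epsilon> *\<^sub>R z) - ?\<xi> - ?H (\<epsilon> *\<^sub>R z)) \<le> \<delta> * norm (\<epsilon> *\<^sub>R z)"
      using r1(2)[of "x + \<epsilon> *\<^sub>R z"] r that by simp
    also have "\<dots> \<le> \<delta> * \<epsilon>" using n \<delta> by (intro mult_left_mono) auto
    finally show ?thesis by (simp add: linear_scale[OF lin])
  qed
  show ?thesis
  proof (rule that[OF r(1,3)])
    show "norm (grad u (x + \<epsilon> *\<^sub>R z) - grad u x - \<epsilon> *\<^sub>R hessian u x z) \<le> \<delta> * \<epsilon>"
      if "0 < \<epsilon>" "\<epsilon> \<le> r" "z \<in> cball 0 1" for \<epsilon> z
      using g that by simp
    show "\<bar>u (x + \<epsilon> *\<^sub>R z) - u x - \<epsilon> * (grad u x \<bullet> z) - \<epsilon>\<^sup>2 * (1/2 * (hessian u x z \<bullet> z))\<bar> \<le> \<delta> * \<epsilon>\<^sup>2"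
      if \<epsilon>: "0 < \<epsilon>" "\<epsilon> \<le> r" and z: "z \<in> cball 0 1" for \<epsilon> z
    proof -
      define \<phi> where "\<phi> t = u (x + t *\<^sub>R z) - t * (?\<xi> \<bullet> z) - t\<^sup>2 * (1/2 * (?H z \<bullet> z))" for t
      define \<phi>' where "\<phi>' t = (grad u (x + t *\<^sub>R z) - ?\<xi> - t *\<^sub>R ?H z) \<bullet> z" for t
      have "norm (\<phi> \<epsilon> - \<phi> 0) \<le> \<delta> * \<epsilon> * norm (\<epsilon> - 0)"
      proof (rule field_differentiable_bound[of "{0..\<epsilon>}" \<phi> \<phi>'])
        fix t assume t: "t \<in> {0..\<epsilon>}"
        have n: "norm (t *\<^sub>R z) \<le> r" using t \<epsilon> z mult_mono[of t r "norm z" 1] by simp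
        then have "x + t *\<^sub>R z \<in> S" using r(3) by (auto simp: subset_iff dist_norm)
        then have d: "(u has_derivative (\<lambda>h. grad u (x + t *\<^sub>R z) \<bullet> h)) (at (x + t *\<^sub>R z))"
          by (rule C2_on_has_derivative[OF u])
        have "((\<lambda>s. u (x + t *\<^sub>R z + s *\<^sub>R z)) has_real_derivative grad u (x + t *\<^sub>R z) \<bullet> z) (at 0)"
          by (rule has_real_derivative_along_line[OF d])
        then have "((\<lambda>s. u (x + (s + t) *\<^sub>R z)) has_real_derivative grad u (x + t *\<^sub>R z) \<bullet> z) (at 0)"
          by (simp add: algebra_simps)
        then have "((\<lambda>s. u (x + s *\<^sub>R z)) has_real_derivative grad u (x + t *\<^sub>R z) \<bullet> z) (at t)"
          using DERIV_shift[of "\<lambda>s. u (x + s *\<^sub>R z)" _ 0 t] by simp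
        then have "(\<phi> has_real_derivative \<phi>' t) (at t)"
          unfolding \<phi>_def \<phi>'_def
          by (auto intro!: derivative_eq_intros simp: inner_diff_left)
        then show "(\<phi> has_real_derivative \<phi>' t) (at t within {0..\<epsilon>})"
          by (rule has_field_derivative_at_within)
        have "\<bar>\<phi>' t\<bar> \<le> norm (grad u (x + t *\<^sub>R z) - ?\<xi> - t *\<^sub>R ?H z) * norm z"
          unfolding \<phi>'_def by (rule Cauchy_Schwarz_ineq2)
        also have "\<dots> \<le> (\<delta> * t) * 1"
          using g[of t z] t \<epsilon> z \<delta> by (intro mult_mono) auto
        also have "\<dots> \<le> \<delta> * \<epsilon>" using t \<delta> by simp
        finally show "norm (\<phi>' t) \<le> \<delta> * \<epsilon>" by simp
      qed (use \<epsilon> in auto)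
      then show ?thesis
        using \<epsilon> by (simp add: \<phi>_def power2_eq_square algebra_simps)
    qed
  qed
qed

text \<open>The parameter \<open>k\<close> encodes the trial value
  \<open>u x + k * \<epsilon>\<^sup>2\<close>, with the argument already divided by \<epsilon>. The
  perturbation result applies with w tending to 1/2 (H z).z - k and its gradient tending to H z; one
  use of it is made for every sequence tending to 0.\<close>

lemma tendsto_integral_signed_powr_rescaled:
  fixes u :: "'a::euclidean_space \<Rightarrow> real"
  assumes S: "open S" "x \<in> S" and u: "C2_on S u" and nz: "grad u x \<noteq> 0" and q: "q \<ge> 0"
  shows "((\<lambda>\<epsilon>. (LINT z|unit_ball_measure. signed_powr q ((u (x + \<epsilon> *\<^sub>R z) - u x) / \<epsilon> - \<epsilon> * k)) / \<epsilon>) \<longlongrightarrow>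
    (LINT z|unit_ball_measure. signed_powr q (grad u x \<bullet> z) * (grad u x \<bullet> z)) / (grad u x \<bullet> grad u x) *
     (1/2 * ((\<Sum>b\<in>Basis. hessian u x b \<bullet> b) + (q - 1) * (hessian u x (grad u x) \<bullet> grad u x) / (grad u x \<bullet> grad u x))
       - k * (real DIM('a) + q + 1))) (at_right 0)"
    (is "(?F \<longlongrightarrow> ?L) _")
proof -
  let ?H = "hessian u x" and ?\<xi> = "grad u x"
  have lin: "linear ?H" using C2_on_has_derivative_grad[OF u S(2)] has_derivative_linear by blast
  then have bl: "bounded_linear ?H" by (simp add: linear_conv_bounded_linear)
  have cH: "continuous_on A ?H" for A using bl by (rule linear_continuous_on)
  define w where "w \<epsilon> z = (u (x + \<epsilon> *\<^sub>R z) - u x - \<epsilon> * (?\<xi> \<bullet> z)) / \<epsilon>\<^sup>2 - k" for \<epsilon> z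
  define dw where "dw \<epsilon> z = (1 / \<epsilon>) *\<^sub>R (grad u (x + \<epsilon> *\<^sub>R z) - ?\<xi>)" for \<epsilon> z
  have small: "\<exists>r>0. cball x r \<subseteq> S \<and> (\<forall>\<epsilon> z. 0 < \<epsilon> \<longrightarrow> \<epsilon> \<le> r \<longrightarrow> z \<in> cball 0 1 \<longrightarrow>
      \<bar>w \<epsilon> z - (1/2 * (?H z \<bullet> z) - k)\<bar> \<le> \<delta> \<and> norm (dw \<epsilon> z - ?H z) \<le> \<delta>)" if \<delta>: "\<delta> > 0" for \<delta>
  proof -
    obtain r where r: "r > 0" "cball x r \<subseteq> S"
      "\<And>\<epsilon> z. 0 < \<epsilon> \<Longrightarrow> \<epsilon> \<le> r \<Longrightarrow> z \<in> cball 0 1 \<Longrightarrow>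
         norm (grad u (x + \<epsilon> *\<^sub>R z) - ?\<xi> - \<epsilon> *\<^sub>R ?H z) \<le> \<delta> * \<epsilon>"
      "\<And>\<epsilon> z. 0 < \<epsilon> \<Longrightarrow> \<epsilon> \<le> r \<Longrightarrow> z \<in> cball 0 1 \<Longrightarrow>
         \<bar>u (x + \<epsilon> *\<^sub>R z) - u x - \<epsilon> * (?\<xi> \<bullet> z) - \<epsilon>\<^sup>2 * (1/2 * (?H z \<bullet> z))\<bar> \<le> \<delta> * \<epsilon>\<^sup>2"
      using second_order_expansion[OF S u \<delta>] by metis
    have "\<bar>w \<epsilon> z - (1/2 * (?H z \<bullet> z) - k)\<bar> \<le> \<delta> \<and> norm (dw \<epsilon> z - ?H z) \<le> \<delta>"
      if \<epsilon>: "0 < \<epsilon>" "\<epsilon> \<le> r" and z: "z \<in> cball 0 1" for \<epsilon> z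
    proof
      have "w \<epsilon> z - (1/2 * (?H z \<bullet> z) - k) =
          (u (x + \<epsilon> *\<^sub>R z) - u x - \<epsilon> * (?\<xi> \<bullet> z) - \<epsilon>\<^sup>2 * (1/2 * (?H z \<bullet> z))) / \<epsilon>\<^sup>2"
        using \<epsilon> by (simp add: w_def diff_divide_distrib)
      then show "\<bar>w \<epsilon> z - (1/2 * (?H z \<bullet> z) - k)\<bar> \<le> \<delta>"
        using r(4)[OF \<epsilon> z] \<epsilon> by (simp add: abs_divide pos_divide_le_eq)
      have "dw \<epsilon> z - ?H z = (1 / \<epsilon>) *\<^sub>R (grad u (x + \<epsilon> *\<^sub>R z) - ?\<xi> - \<epsilon> *\<^sub>R ?H z)"
        using \<epsilon> by (simp add: dw_def scaleR_diff_right)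
      then show "norm (dw \<epsilon> z - ?H z) \<le> \<delta>"
        using r(3)[OF \<epsilon> z] \<epsilon> by (simp add: pos_divide_le_eq)
    qed
    then show ?thesis using r(1,2) by blast
  qed
  obtain r where r: "r > 0" "cball x r \<subseteq> S"
    "\<And>\<epsilon> z. 0 < \<epsilon> \<Longrightarrow> \<epsilon> \<le> r \<Longrightarrow> z \<in> cball 0 1 \<Longrightarrow> \<bar>w \<epsilon> z - (1/2 * (?H z \<bullet> z) - k)\<bar> \<le> 1 \<and> norm (dw \<epsilon> z - ?H z) \<le> 1"
    using small[of 1] by auto
  obtain C1 where C1: "C1 > 0" "\<And>z. z \<in> cball 0 1 \<Longrightarrow> norm (1/2 * (?H z \<bullet> z) - k) \<le> C1"
  proof -
    have "continuous_on (cball 0 1) (\<lambda>z. 1/2 * (?H z \<bullet> z) - k)"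
      by (intro continuous_intros cH)
    then show ?thesis using bounded_cball_continuous that by blast
  qed
  obtain C2 where C2: "C2 > 0" "\<And>z. z \<in> cball 0 1 \<Longrightarrow> norm (?H z) \<le> C2"
    using bounded_cball_continuous[OF cH] by blast
  show ?thesis
    unfolding tendsto_at_iff_sequentially
  proof (intro allI impI)
    fix X :: "nat \<Rightarrow> real" assume X: "\<forall>i. X i \<in> {0<..} - {0}" "X \<longlonglongrightarrow> 0"
    \<comment> \<open>The perturbation result wants its bounds for every index, so an initial
      segment of the sequence is dropped and restored at the end by an offset.\<close>
    have "\<forall>\<^sub>F n in sequentially. X n < min 1 r"
      using X(2) r(1) by (intro order_tendstoD) auto
    then obtain n0 where n0: "\<And>n. n \<ge> n0 \<Longrightarrow> X n < min 1 r" unfolding eventually_sequentially by blast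
    define e where "e n = X (n + n0)" for n
    have e: "0 < e n" "e n \<le> 1" "e n \<le> r" "e \<longlonglongrightarrow> 0" for n
      using X(1) n0[of "n + n0"] LIMSEQ_ignore_initial_segment[OF X(2), of n0] by (auto simp: e_def[abs_def])
    define f where "f n z = (u (x + e n *\<^sub>R z) - u x) / e n - e n * k" for n z
    define df where "df n z = grad u (x + e n *\<^sub>R z)" for n z
    have inS: "x + e n *\<^sub>R z \<in> S" if "z \<in> cball 0 1" for n z
    proof -
      have "norm (e n *\<^sub>R z) \<le> r" using e(1,3)[of n] that mult_mono[of "e n" r "norm z" 1] by simp
      then show ?thesis using r(2) by (auto simp: subset_iff dist_norm)
    qed
    have cont: "continuous_on (cball 0 1) (\<lambda>z. u (x + e n *\<^sub>R z))"
        "continuous_on (cball 0 1) (\<lambda>z. grad u (x + e n *\<^sub>R z))" for n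
      by (rule continuous_on_compose2[OF C2_on_continuous_on[OF u]] continuous_on_compose2[OF C2_on_continuous_on_grad[OF u]],
        intro continuous_intros, use inS in auto)+
    have "(\<lambda>n. (LINT z|unit_ball_measure. signed_powr q (f n z)) / e n) \<longlonglongrightarrow>
      ((real DIM('a) + q + 1) * (LINT z|unit_ball_measure. signed_powr q (?\<xi> \<bullet> z) * ((?\<xi> \<bullet> z) * (1/2 * (?H z \<bullet> z) - k)))
       - (LINT z|unit_ball_measure. signed_powr q (?\<xi> \<bullet> z) * (?H z \<bullet> (?\<xi> - (?\<xi> \<bullet> z) *\<^sub>R z)))) / (?\<xi> \<bullet> ?\<xi>)"
    proof (rule tendsto_integral_signed_powr_perturbation[OF q nz e(1,2,4), where df=df and w="\<lambda>n. w (e n)" and dw="\<lambda>n. dw (e n)" and C="max (C1 + 1) (C2 + 1)"])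
      fix n and z :: 'a assume z: "z \<in> cball 0 1"
      have en: "e n \<noteq> 0" using e(1)[of n] by simp
      show "f n z = ?\<xi> \<bullet> z + e n * w (e n) z"
        using en by (simp add: f_def w_def field_simps power2_eq_square)
      show "df n z = ?\<xi> + e n *\<^sub>R dw (e n) z"
        using en by (simp add: df_def dw_def)
      have "((\<lambda>z. x + e n *\<^sub>R z) has_derivative (\<lambda>h. e n *\<^sub>R h)) (at z)"
        by (auto intro!: derivative_eq_intros)
      from has_derivative_compose[OF this C2_on_has_derivative[OF u inS[OF z, of n]]]
      have "((\<lambda>z. u (x + e n *\<^sub>R z)) has_derivative (\<lambda>h. grad u (x + e n *\<^sub>R z) \<bullet> (e n *\<^sub>R h))) (at z)" .
      then show "(f n has_derivative (\<lambda>h. df n z \<bullet> h)) (at z)"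
        unfolding f_def[abs_def] df_def using en
        by (auto intro!: derivative_eq_intros simp: field_simps)
      show "\<bar>w (e n) z\<bar> \<le> max (C1 + 1) (C2 + 1)"
        using r(3)[OF e(1,3) z, of n] C1(2)[OF z] by auto
      have "norm (dw (e n) z) \<le> norm (?H z) + norm (dw (e n) z - ?H z)"
        by (metis norm_triangle_sub)
      then show "norm (dw (e n) z) \<le> max (C1 + 1) (C2 + 1)"
        using r(3)[OF e(1,3) z, of n] C2(2)[OF z] by auto
    next
      fix z :: 'a assume z: "z \<in> cball 0 1"
      have ev: "\<forall>\<^sub>F n in sequentially. \<bar>w (e n) z - (1/2 * (?H z \<bullet> z) - k)\<bar> < \<delta> \<and> norm (dw (e n) z - ?H z) < \<delta>"
        if "\<delta> > 0" for \<delta>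
      proof -
        obtain r' where r': "r' > 0" "\<And>\<epsilon> z. 0 < \<epsilon> \<Longrightarrow> \<epsilon> \<le> r' \<Longrightarrow> z \<in> cball 0 1 \<Longrightarrow>
          \<bar>w \<epsilon> z - (1/2 * (?H z \<bullet> z) - k)\<bar> \<le> \<delta> / 2 \<and> norm (dw \<epsilon> z - ?H z) \<le> \<delta> / 2"
          using small[of "\<delta> / 2"] \<open>\<delta> > 0\<close> by auto
        have "\<forall>\<^sub>F n in sequentially. e n < r'" using e(4) r'(1) by (intro order_tendstoD) auto
        then show ?thesis
        proof eventually_elim
          case (elim n)
          then show ?case using r'(2)[OF e(1)[of n] _ z] \<open>\<delta> > 0\<close> by force
        qed
      qed
      show "(\<lambda>n. w (e n) z) \<longlonglongrightarrow> 1/2 * (?H z \<bullet> z) - k"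
        unfolding tendsto_iff dist_real_def using ev unfolding eventually_conj_iff by blast
      show "(\<lambda>n. dw (e n) z) \<longlonglongrightarrow> ?H z"
        unfolding tendsto_iff dist_norm using ev unfolding eventually_conj_iff by blast
    next
      fix n
      show "continuous_on (cball 0 1) (w (e n))"
        unfolding w_def[abs_def] using e(1)[of n] by (intro continuous_intros cont) auto
      show "continuous_on (cball 0 1) (dw (e n))"
        unfolding dw_def[abs_def] by (intro continuous_intros cont)
    qed (intro continuous_intros cH)+
    then have "(\<lambda>n. (LINT z|unit_ball_measure. signed_powr q (f n z)) / e n) \<longlonglongrightarrow> ?L"
      unfolding integral_first_variation_eq[OF q nz lin] .
    then have "(\<lambda>n. (?F \<circ> X) (n + n0)) \<longlonglongrightarrow> ?L"
      by (simp add: f_def e_def o_def)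
    then show "(?F \<circ> X) \<longlonglongrightarrow> ?L" by (rule LIMSEQ_offset)
  qed
qed

section \<open>Localization of the minimizer\<close>

lemma measure_lebesgue_on_ball_pos:
  assumes "e > 0"
  shows "measure (lebesgue_on (ball (x::'a::euclidean_space) e)) (space (lebesgue_on (ball x e))) > 0"
  using content_ball_pos[OF assms, of x] by (simp add: measure_restrict_space space_restrict_space)

text \<open>A nonempty open set is not null, so it meets every set of full measure. This turns
  almost-everywhere statements into points.\<close>

lemma open_ball_AE_ex:
  assumes "AE y in lebesgue_on (ball (x::'a::euclidean_space) e). P y" "open A" "A \<subseteq> ball x e" "A \<noteq> {}"
  obtains y where "y \<in> A" "P y"
proof -
  have "AE y in lebesgue. y \<in> ball x e \<longrightarrow> P y"
    using assms(1) by (subst (asm) AE_restrict_space_iff) auto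
  then have "AE y in lebesgue. y \<notin> A" if "\<forall>y\<in>A. \<not> P y"
    by eventually_elim (use that assms(3) in blast)
  then have "negligible A" if "\<forall>y\<in>A. \<not> P y"
    unfolding negligible_iff_null_sets using assms(2) that by (subst AE_iff_null_sets) auto
  then show ?thesis
    using open_not_negligible[OF assms(2,4)] that by blast
qed

lemma integral_signed_powr_pos:
  fixes v :: "'a::euclidean_space \<Rightarrow> real"
  assumes v: "continuous_on (cball x e) v" and e: "e > 0" and q: "q \<ge> 0" and d: "d > 0"
    and ge: "\<And>y. y \<in> ball x e \<Longrightarrow> v y \<ge> d"
  shows "(LINT y|lebesgue_on (ball x e). signed_powr q (v y)) > 0"
proof -
  let ?M = "lebesgue_on (ball x e)"
  have "0 < measure ?M (space ?M) * d powr q"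
    using measure_lebesgue_on_ball_pos[OF e] d by (intro mult_pos_pos) auto
  also have "\<dots> = (LINT y|?M. d powr q)" by simp
  also have "\<dots> \<le> (LINT y|?M. signed_powr q (v y))"
  proof (rule integral_mono)
    show "integrable ?M (\<lambda>y. d powr q)" by (intro integrable_ball_continuous continuous_intros)
    show "integrable ?M (\<lambda>y. signed_powr q (v y))"
      using integrable_signed_powr_continuous[OF q v, of "\<lambda>_. 1"] by (simp add: continuous_intros)
    fix y assume "y \<in> space ?M"
    then have "v y \<ge> d" using ge by (simp add: space_restrict_space)
    then show "d powr q \<le> signed_powr q (v y)"
      using d q by (simp add: signed_powr_def powr_mono2)
  qed
  finally show ?thesis .
qed

text \<open>Uniqueness also covers \<open>q = 0\<close>: between two minimizers the integrand is
  strictly convex at the points \<open>y\<close> with \<open>u y\<close> strictly between them, and such points exist because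
  the ball is connected.\<close>

lemma mu_p_between:
  fixes u :: "'a::euclidean_space \<Rightarrow> real"
  assumes u: "continuous_on (cball x e) u" and e: "e > 0" and q: "q \<ge> 0" and l12: "l1 \<le> l2"
    and pos: "(LINT y|lebesgue_on (ball x e). signed_powr q (u y - l1)) > 0"
    and neg: "(LINT y|lebesgue_on (ball x e). signed_powr q (u y - l2)) < 0"
  shows "l1 \<le> mu_p (ereal (q + 1)) e u x" "mu_p (ereal (q + 1)) e u x \<le> l2"
proof -
  let ?M = "lebesgue_on (ball x e)"
  define F where "F l = (LINT y|?M. \<bar>u y - l\<bar> powr (q + 1))" for l
  define \<Phi> where "\<Phi> l = (LINT y|?M. signed_powr q (u y - l))" for l
  have cu: "continuous_on (cball x e) (\<lambda>y. u y - l)" for l by (intro continuous_intros u)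
  have iF: "integrable ?M (\<lambda>y. \<bar>u y - l\<bar> powr (q + 1))" for l
    by (intro integrable_ball_continuous continuous_intros u q)
  have i\<Phi>: "integrable ?M (\<lambda>y. signed_powr q (u y - l))" for l
    using integrable_signed_powr_continuous[OF q cu, of "\<lambda>_. 1"] by (simp add: continuous_intros)
  have F0: "F l \<ge> 0" for l unfolding F_def by (intro Bochner_Integration.integral_nonneg) auto
  \<comment> \<open>Integrated supporting-line inequality: -(q+1) \<Phi>(a) is a subgradient of F at
    a. The signs of \<Phi> at \<open>l1\<close> and \<open>l2\<close> thereby exclude minimizers
    outside the interval, and bounds on \<Phi> make F Lipschitz inside it.\<close>
  have sub: "(q + 1) * (a - b) * \<Phi> a \<le> F b - F a" for a b
  proof -
    have "(q + 1) * (a - b) * \<Phi> a = (LINT y|?M. (q + 1) * (a - b) * signed_powr q (u y - a))"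
      by (simp add: \<Phi>_def)
    also have "\<dots> \<le> (LINT y|?M. \<bar>u y - b\<bar> powr (q + 1) - \<bar>u y - a\<bar> powr (q + 1))"
    proof (rule integral_mono)
      fix y
      show "(q + 1) * (a - b) * signed_powr q (u y - a) \<le> \<bar>u y - b\<bar> powr (q + 1) - \<bar>u y - a\<bar> powr (q + 1)"
        using abs_powr_diff_ge[OF q, of "u y - a" "u y - b"] by (simp add: mult_ac)
    qed (intro integrable_mult_right Bochner_Integration.integrable_diff iF i\<Phi>)+
    also have "\<dots> = F b - F a" unfolding F_def by (intro Bochner_Integration.integral_diff iF)
    finally show ?thesis .
  qed
  have low: "F l > F l1" if "l < l1" for l
  proof -
    have "(q + 1) * (l1 - l) * \<Phi> l1 > 0"
      using pos that q unfolding \<Phi>_def by (intro mult_pos_pos) auto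
    then show ?thesis using sub[of l1 l] by simp
  qed
  have high: "F l > F l2" if "l > l2" for l
  proof -
    have "(q + 1) * (l2 - l) * \<Phi> l2 > 0"
      using neg that q unfolding \<Phi>_def by (intro mult_neg_neg) (auto simp: mult_less_0_iff)
    then show ?thesis using sub[of l2 l] by simp
  qed
  obtain B where B: "B > 0" "\<And>y. y \<in> cball x e \<Longrightarrow> norm (u y) \<le> B"
    using bounded_cball_continuous[OF u] by blast
  define A where "A = (B + \<bar>l1\<bar> + \<bar>l2\<bar>) powr q"
  define L where "L = (q + 1) * (measure ?M (space ?M) * A)"
  have b\<Phi>: "\<bar>\<Phi> l\<bar> \<le> measure ?M (space ?M) * A" if "l \<in> {l1..l2}" for l
  proof -
    have "\<bar>\<Phi> l\<bar> \<le> (LINT y|?M. \<bar>signed_powr q (u y - l)\<bar>)" unfolding \<Phi>_def by (rule integral_abs_bound)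
    also have "\<dots> \<le> (LINT y|?M. A)"
    proof (rule integral_mono)
      fix y assume "y \<in> space ?M"
      then have "\<bar>u y\<bar> \<le> B" using B(2)[of y] by (simp add: space_restrict_space)
      then show "\<bar>signed_powr q (u y - l)\<bar> \<le> A"
        unfolding A_def using that by (intro abs_signed_powr_le q) auto
    qed (intro integrable_abs i\<Phi> integrable_ball_continuous continuous_intros)+
    finally show ?thesis by simp
  qed
  have lip: "F a - F b \<le> L * \<bar>a - b\<bar>" if "a \<in> {l1..l2}" for a b
  proof -
    have "F a - F b \<le> - ((q + 1) * (a - b) * \<Phi> a)" using sub[of a b] by simp
    also have "\<dots> \<le> \<bar>(q + 1) * (a - b) * \<Phi> a\<bar>" by simp
    also have "\<dots> = (q + 1) * \<bar>a - b\<bar> * \<bar>\<Phi> a\<bar>" using q by (simp add: abs_mult)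
    also have "\<dots> \<le> (q + 1) * \<bar>a - b\<bar> * (measure ?M (space ?M) * A)"
      using b\<Phi>[OF that] q by (intro mult_left_mono) auto
    finally show ?thesis by (simp add: L_def mult_ac)
  qed
  have "continuous_on {l1..l2} F"
  proof (rule lipschitz_on_continuous_on[of L], rule lipschitz_onI)
    show "dist (F a) (F b) \<le> L * dist a b" if "a \<in> {l1..l2}" "b \<in> {l1..l2}" for a b
      using lip[of a b] lip[of b a] that by (simp add: dist_real_def abs_minus_commute)
    show "0 \<le> L" using q by (simp add: L_def A_def)
  qed
  then obtain m where m: "m \<in> {l1..l2}" "\<And>l. l \<in> {l1..l2} \<Longrightarrow> F m \<le> F l"
    using continuous_attains_inf[of "{l1..l2}" F] l12 by auto
  have min: "F m \<le> F l" for l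
  proof -
    consider "l < l1" | "l \<in> {l1..l2}" | "l > l2" by fastforce
    then show ?thesis
      using low[of l] high[of l] m(2)[of l] m(2)[of l1] m(2)[of l2] l12 by cases auto
  qed
  have nodiff: False if a: "\<And>l. F a \<le> F l" and b: "\<And>l. F b \<le> F l" and ab: "a < b" for a b
  proof -
    \<comment> \<open>The midpoint competes with both minimizers. If \<open>u\<close> took no value
      strictly between them, connectedness would put all values on one side, \<Phi>(c) would have a
      strict sign, and \<open>c\<close> would beat the minimizer on the other side.\<close>
    define c where "c = (a + b) / 2"
    have c: "a < c" "c < b" "b - c = c - a" "(b - a) / 2 = c - a" using ab by (auto simp: c_def field_simps)
    have "\<exists>y\<in>ball x e. a < u y \<and> u y < b"
    proof (rule ccontr)
      assume none: "\<not> (\<exists>y\<in>ball x e. a < u y \<and> u y < b)"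
      have conn: "connected (u ` ball x e)"
        by (intro connected_continuous_image connected_ball continuous_on_subset[OF u ball_subset_cball])
      have "(\<forall>y\<in>ball x e. u y \<le> a) \<or> (\<forall>y\<in>ball x e. u y \<ge> b)"
      proof (rule ccontr)
        assume "\<not> ?thesis"
        then obtain y1 y2 where y: "y1 \<in> ball x e" "y2 \<in> ball x e" "u y1 > a" "u y2 < b" by force
        then have "u y1 \<ge> b" "u y2 \<le> a" using none by (meson not_le)+
        then have "u y1 \<ge> c" "u y2 \<le> c" using c by auto
        then have "c \<in> u ` ball x e"
          using connectedD_interval[OF conn, of "u y2" "u y1" c] y by auto
        then show False using none c by auto
      qed
      then show False
      proof
        assume le: "\<forall>y\<in>ball x e. u y \<le> a"
        have "(LINT y|?M. signed_powr q (c - u y)) > 0"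
          by (rule integral_signed_powr_pos[where d="c - a"]) (use c le e q in \<open>auto intro!: continuous_intros u\<close>)
        moreover have "signed_powr q (u y - c) = - signed_powr q (c - u y)" for y
          using signed_powr_minus[of q "c - u y"] by simp
        ultimately have "\<Phi> c < 0" unfolding \<Phi>_def by simp
        then have "(q + 1) * (c - b) * \<Phi> c > 0" using c q by (intro mult_neg_neg) (auto simp: mult_less_0_iff)
        then show False using sub[of c b] b[of c] by simp
      next
        assume ge: "\<forall>y\<in>ball x e. b \<le> u y"
        have "\<Phi> c > 0" unfolding \<Phi>_def
          by (rule integral_signed_powr_pos[where d="b - c"]) (use c ge e q in \<open>auto intro!: continuous_intros u\<close>)
        then have "(q + 1) * (c - a) * \<Phi> c > 0" using c q by (intro mult_pos_pos) auto
        then show False using sub[of c a] a[of c] by simp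
      qed
    qed
    then obtain y0 where y0: "y0 \<in> ball x e" "a < u y0" "u y0 < b" by blast
    \<comment> \<open>Midpoint convexity defect. It is nonnegative with integral at most 0, hence
      zero almost everywhere, although it is positive on a nonempty open set.\<close>
    define h where "h y = 1/2 * \<bar>u y - a\<bar> powr (q + 1) + 1/2 * \<bar>u y - b\<bar> powr (q + 1) - \<bar>u y - c\<bar> powr (q + 1)" for y
    have mid: "((s + t) / 2) powr (q + 1) \<le> 1/2 * s powr (q + 1) + 1/2 * t powr (q + 1)"
      if "s \<ge> 0" "t \<ge> 0" for s t :: real
      using abs_powr_diff_ge[OF q, of "(s + t) / 2" s] abs_powr_diff_ge[OF q, of "(s + t) / 2" t] that
      by (simp add: field_simps)
    have h0: "h y \<ge> 0" for y
    proof -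
      have "\<bar>u y - c\<bar> powr (q + 1) \<le> ((\<bar>u y - a\<bar> + \<bar>u y - b\<bar>) / 2) powr (q + 1)"
        using q by (intro powr_mono2) (auto simp: c_def abs_if field_simps)
      then show ?thesis using mid[of "\<bar>u y - a\<bar>" "\<bar>u y - b\<bar>"] by (simp add: h_def)
    qed
    have hpos: "h y > 0" if "a < u y" "u y < b" for y
    proof -
      \<comment> \<open>Strictly between \<open>a\<close> and \<open>b\<close> the two distances add
        up to b - a, while the distance to the midpoint is less than half of that. The strictness
        thus comes from the triangle inequality and survives for \<open>q = 0\<close>.\<close>
      have "\<bar>u y - c\<bar> powr (q + 1) < ((\<bar>u y - a\<bar> + \<bar>u y - b\<bar>) / 2) powr (q + 1)"
        using q that by (intro powr_less_mono2) (auto simp: c_def abs_if field_simps)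
      then show ?thesis using mid[of "\<bar>u y - a\<bar>" "\<bar>u y - b\<bar>"] by (simp add: h_def)
    qed
    have ih: "integrable ?M h"
      unfolding h_def by (intro Bochner_Integration.integrable_diff Bochner_Integration.integrable_add integrable_mult_right iF)
    have "integral\<^sup>L ?M h = 1/2 * F a + 1/2 * F b - F c"
      unfolding h_def F_def
      by (simp only: Bochner_Integration.integral_diff Bochner_Integration.integral_add
        Bochner_Integration.integrable_add integrable_mult_right iF integral_mult_right_zero)
    also have "\<dots> \<le> 0" using a[of c] b[of c] by simp
    finally have "integral\<^sup>L ?M h = 0"
      using Bochner_Integration.integral_nonneg[of ?M h] h0 by fastforce
    then have "AE y in ?M. h y = 0"
      using integral_nonneg_eq_0_iff_AE[OF ih] h0 by simp
    moreover have "open (ball x e \<inter> u -` {a<..<b})"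
      by (rule continuous_open_preimage[OF continuous_on_subset[OF u ball_subset_cball]]) auto
    ultimately obtain y where "y \<in> ball x e \<inter> u -` {a<..<b}" "h y = 0"
      by (rule open_ball_AE_ex) (use y0 in auto)
    then show False using hpos[of y] by simp
  qed
  have eqF: "Lp_norm (ereal (q + 1)) ?M (\<lambda>y. u y - a) \<le> Lp_norm (ereal (q + 1)) ?M (\<lambda>y. u y - b) \<longleftrightarrow> F a \<le> F b" for a b
  proof -
    have "F a powr (1 / (q + 1)) \<le> F b powr (1 / (q + 1)) \<longleftrightarrow> F a \<le> F b"
      using powr_mono2[of "1 / (q + 1)" "F a" "F b"] powr_less_mono2[of "1 / (q + 1)" "F b" "F a"]
        F0[of a] F0[of b] q
      by (cases "F a \<le> F b") (auto simp: not_le)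
    then show ?thesis by (simp add: Lp_norm_def F_def)
  qed
  have "mu_p (ereal (q + 1)) e u x = m"
    unfolding mu_p_def eqF
  proof (rule the_equality)
    show "\<forall>l. F m \<le> F l" using min by blast
    show "m' = m" if "\<forall>l. F m' \<le> F l" for m'
      using nodiff[OF min, of m'] nodiff[OF _ min, of m'] that by (cases m m' rule: linorder_cases) auto
  qed
  then show "l1 \<le> mu_p (ereal (q + 1)) e u x" "mu_p (ereal (q + 1)) e u x \<le> l2" using m(1) by auto
qed

section \<open>The case p = infinity: supremum norms and extrema on small balls\<close>

lemma Lp_norm_infinity_ball:
  fixes v :: "'a::euclidean_space \<Rightarrow> real"
  assumes v: "continuous_on (cball x e) v" and e: "e > 0"
    and le: "\<And>y. y \<in> cball x e \<Longrightarrow> \<bar>v y\<bar> \<le> A" and y0: "y0 \<in> cball x e" "\<bar>v y0\<bar> = A"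
  shows "Lp_norm \<infinity> (lebesgue_on (ball x e)) v = A"
proof -
  let ?M = "lebesgue_on (ball x e)" and ?f = "\<lambda>y. ereal \<bar>v y\<bar>"
  have meas: "?f \<in> borel_measurable ?M"
    using measurable_ball_continuous[OF v] by measurable
  have "esssup ?M ?f = ereal A"
  proof (rule antisym)
    show "esssup ?M ?f \<le> ereal A"
      by (rule esssup_I[OF meas], rule AE_I2) (use le in \<open>simp add: space_restrict_space\<close>)
    show "ereal A \<le> esssup ?M ?f"
    proof (rule ccontr)
      assume "\<not> ?thesis"
      then obtain s where s: "esssup ?M ?f < ereal s" "ereal s < ereal A"
        using ereal_dense2[of "esssup ?M ?f" "ereal A"] by (auto simp: not_le)
      have ae: "AE y in ?M. \<bar>v y\<bar> \<le> s"
        using esssup_AE[of ?f ?M]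
      proof eventually_elim
        case (elim y)
        then have "ereal \<bar>v y\<bar> < ereal s" using s(1) by (rule order.strict_trans1)
        then show ?case by simp
      qed
      have cv: "continuous_on (ball x e) (\<lambda>y. \<bar>v y\<bar>)"
        by (intro continuous_intros continuous_on_subset[OF v ball_subset_cball])
      have op: "open (ball x e \<inter> (\<lambda>y. \<bar>v y\<bar>) -` {s<..})"
        by (rule continuous_open_preimage[OF cv]) auto
      \<comment> \<open>The maximum may be attained only on the sphere, outside the domain of the
        measure; continuity extends a bound from the open ball to its closure.\<close>
      have ne: "ball x e \<inter> (\<lambda>y. \<bar>v y\<bar>) -` {s<..} \<noteq> {}"
      proof
        assume none: "ball x e \<inter> (\<lambda>y. \<bar>v y\<bar>) -` {s<..} = {}"
        have "\<bar>v y0\<bar> \<le> s"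
        proof (rule continuous_le_on_closure[of "ball x e" "\<lambda>y. \<bar>v y\<bar>"])
          show "continuous_on (closure (ball x e)) (\<lambda>y. \<bar>v y\<bar>)"
            using e v by (auto intro!: continuous_intros)
          show "y0 \<in> closure (ball x e)" using y0 e by simp
          show "\<bar>v y\<bar> \<le> s" if "y \<in> ball x e" for y using none that by (auto simp: not_less[symmetric])
        qed
        then show False using s(2) y0 by simp
      qed
      show False
        by (rule open_ball_AE_ex[OF ae op _ ne]) auto
    qed
  qed
  then show ?thesis by (simp add: Lp_norm_def)
qed

text \<open>The supremum norm of u - l is the larger of b - l and l - a, that is, half the
  oscillation plus the distance from l to the midpoint.\<close>

lemma mu_p_infinity:
  fixes u :: "'a::euclidean_space \<Rightarrow> real"
  assumes u: "continuous_on (cball x e) u" and e: "e > 0"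
    and b: "\<And>y. y \<in> cball x e \<Longrightarrow> u y \<le> b" "y1 \<in> cball x e" "u y1 = b"
    and a: "\<And>y. y \<in> cball x e \<Longrightarrow> a \<le> u y" "y2 \<in> cball x e" "u y2 = a"
  shows "mu_p \<infinity> e u x = (a + b) / 2"
proof -
  have "Lp_norm \<infinity> (lebesgue_on (ball x e)) (\<lambda>y. u y - l) = \<bar>(b - a) / 2\<bar> + \<bar>(a + b) / 2 - l\<bar>" for l
  proof -
    have ab: "a \<le> b" using a(1)[OF b(2)] b(3) by simp
    show ?thesis
    proof (rule Lp_norm_infinity_ball[where ?y0.0="if l \<le> (a + b) / 2 then y1 else y2"])
      show "continuous_on (cball x e) (\<lambda>y. u y - l)" by (intro continuous_intros u)
      show "\<bar>u y - l\<bar> \<le> \<bar>(b - a) / 2\<bar> + \<bar>(a + b) / 2 - l\<bar>" if "y \<in> cball x e" for y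
        using a(1)[OF that] b(1)[OF that] by (auto simp: abs_if field_simps)
      show "\<bar>u (if l \<le> (a + b) / 2 then y1 else y2) - l\<bar> = \<bar>(b - a) / 2\<bar> + \<bar>(a + b) / 2 - l\<bar>"
        using ab b(3) a(3) by (auto simp: abs_if field_simps)
    qed (use e a b in auto)
  qed
  then show ?thesis
    unfolding mu_p_def by (intro the_equality) (auto dest: spec[of _ "(a + b) / 2"])
qed

text \<open>The lower bound tests the direction \<xi>/|\<xi>|. For the upper bound, a maximizer at
  distance d from that direction loses at least e |\<xi>| d^2 / 2 in the linear term but gains at
  most e^2 B d in the quadratic one; the net gain is of order e^3.\<close>

lemma maximum_on_ball_expansion:
  fixes u :: "'a::euclidean_space \<Rightarrow> real" and \<xi> :: 'a
  assumes \<xi>: "\<xi> \<noteq> 0" and H: "linear H" and B: "\<And>z. norm (H z) \<le> B * norm z" and e: "e > 0"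
    and exp: "\<And>z. z \<in> cball 0 1 \<Longrightarrow>
      \<bar>u (x + e *\<^sub>R z) - u0 - e * (\<xi> \<bullet> z) - e\<^sup>2 * (1/2 * (H z \<bullet> z))\<bar> \<le> \<delta> * e\<^sup>2"
    and b: "\<And>y. y \<in> cball x e \<Longrightarrow> u y \<le> b" "y1 \<in> cball x e" "u y1 = b"
  shows "\<bar>b - (u0 + e * norm \<xi> + e\<^sup>2 * (1/2 * ((H \<xi> \<bullet> \<xi>) / (norm \<xi>)\<^sup>2)))\<bar>
    \<le> \<delta> * e\<^sup>2 + e ^ 3 * (B\<^sup>2 / (2 * norm \<xi>))"
proof -
  define n where "n = norm \<xi>"
  have n: "n > 0" using \<xi> by (simp add: n_def)
  define z0 where "z0 = (1 / n) *\<^sub>R \<xi>"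
  have z0: "norm z0 = 1" using \<xi> by (simp add: z0_def n_def)
  have \<xi>z0: "\<xi> = n *\<^sub>R z0" using n by (simp add: z0_def)
  have Hz0: "(H \<xi> \<bullet> \<xi>) / (norm \<xi>)\<^sup>2 = H z0 \<bullet> z0"
    using n by (simp add: z0_def linear_scale[OF H] power2_eq_square flip: n_def)
  have z0z0: "z0 \<bullet> z0 = 1" using z0 by (simp add: dot_square_norm)
  have B0: "B \<ge> 0" using order_trans[OF norm_ge_zero B[of z0]] z0 by simp
  have "x + e *\<^sub>R z0 \<in> cball x e" using e z0 by (simp add: dist_norm)
  then have "u (x + e *\<^sub>R z0) \<le> b" by (rule b)
  moreover have "u (x + e *\<^sub>R z0) \<ge> u0 + e * n + e\<^sup>2 * (1/2 * (H z0 \<bullet> z0)) - \<delta> * e\<^sup>2"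
    using exp[of z0] z0 \<xi>z0 z0z0 by simp
  moreover have "0 \<le> e ^ 3 * (B\<^sup>2 / (2 * n))" using e n by simp
  ultimately have 1: "b \<ge> u0 + e * n + e\<^sup>2 * (1/2 * (H z0 \<bullet> z0)) - (\<delta> * e\<^sup>2 + e ^ 3 * (B\<^sup>2 / (2 * n)))"
    by linarith
  define z where "z = (1 / e) *\<^sub>R (y1 - x)"
  have y1: "y1 = x + e *\<^sub>R z" using e by (simp add: z_def)
  have z: "norm z \<le> 1" using b(2) e by (simp add: z_def dist_norm norm_minus_commute)
  define d where "d = norm (z - z0)"
  have "d\<^sup>2 = z \<bullet> z - 2 * (z0 \<bullet> z) + 1"
    by (simp add: d_def power2_norm_eq_inner inner_diff_left inner_diff_right inner_commute z0z0)
  also have "z \<bullet> z \<le> 1" using z by (simp add: dot_square_norm power_le_one)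
  finally have "d\<^sup>2 \<le> 2 - 2 * (z0 \<bullet> z)" by simp
  then have lin: "\<xi> \<bullet> z \<le> n - n * d\<^sup>2 / 2"
    using n mult_left_mono[of "d\<^sup>2" "2 - 2 * (z0 \<bullet> z)" n] by (simp add: \<xi>z0 algebra_simps)
  have "H z \<bullet> z - H z0 \<bullet> z0 = H z \<bullet> (z - z0) + H (z - z0) \<bullet> z0"
    by (simp add: linear_diff[OF H] inner_diff_left inner_diff_right)
  also have "\<dots> \<le> norm (H z) * d + norm (H (z - z0)) * norm z0"
    unfolding d_def by (intro add_mono norm_cauchy_schwarz)
  also have "\<dots> \<le> (B * 1) * d + (B * d) * 1"
  proof (intro add_mono mult_mono)
    show "norm (H z) \<le> B * 1" using B[of z] mult_left_mono[OF z B0] by linarith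
  qed (use B[of "z - z0"] B0 z0 in \<open>auto simp: d_def\<close>)
  finally have quad: "H z \<bullet> z \<le> H z0 \<bullet> z0 + 2 * B * d" by simp
  have "b \<le> u0 + e * (\<xi> \<bullet> z) + e\<^sup>2 * (1/2 * (H z \<bullet> z)) + \<delta> * e\<^sup>2"
    using exp[of z] z b(3) y1 by simp
  also have "\<dots> \<le> u0 + e * (n - n * d\<^sup>2 / 2) + e\<^sup>2 * (1/2 * (H z0 \<bullet> z0 + 2 * B * d)) + \<delta> * e\<^sup>2"
  proof -
    have "e * (\<xi> \<bullet> z) \<le> e * (n - n * d\<^sup>2 / 2)" using lin e by (intro mult_left_mono) auto
    moreover have "e\<^sup>2 * (1/2 * (H z \<bullet> z)) \<le> e\<^sup>2 * (1/2 * (H z0 \<bullet> z0 + 2 * B * d))"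
      using quad by (intro mult_left_mono) auto
    ultimately show ?thesis by linarith
  qed
  also have "\<dots> = u0 + e * n + e\<^sup>2 * (1/2 * (H z0 \<bullet> z0)) + \<delta> * e\<^sup>2 + e * (e * B * d - n * d\<^sup>2 / 2)"
    by (simp add: algebra_simps power2_eq_square)
  \<comment> \<open>Completing the square in d: the left side is largest at d = e B / n, which
    explains the constant B^2 / (2 n).\<close>
  also have "e * (e * B * d - n * d\<^sup>2 / 2) \<le> e * (e\<^sup>2 * B\<^sup>2 / (2 * n))"
  proof (rule mult_left_mono)
    have "e\<^sup>2 * B\<^sup>2 / (2 * n) - (e * B * d - n * d\<^sup>2 / 2) = (e * B - n * d)\<^sup>2 / (2 * n)"
      using n by (simp add: field_simps power2_eq_square)
    moreover have "\<dots> \<ge> 0" using n by simp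
    ultimately show "e * B * d - n * d\<^sup>2 / 2 \<le> e\<^sup>2 * B\<^sup>2 / (2 * n)" by simp
  qed (use e in simp)
  also have "e * (e\<^sup>2 * B\<^sup>2 / (2 * n)) = e ^ 3 * (B\<^sup>2 / (2 * n))"
    by (simp add: power3_eq_cube power2_eq_square)
  finally have 2: "b \<le> u0 + e * n + e\<^sup>2 * (1/2 * (H z0 \<bullet> z0)) + \<delta> * e\<^sup>2 + e ^ 3 * (B\<^sup>2 / (2 * n))" by simp
  show ?thesis
    unfolding abs_le_iff n_def[symmetric] Hz0[folded n_def] using 1 2 by linarith
qed

section \<open>The asymptotic expansion\<close>

lemma p_laplacian_quotient_ereal:
  fixes u :: "'a::euclidean_space \<Rightarrow> real"
  assumes "grad u differentiable (at x)" "grad u x \<noteq> 0"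
  shows "p_laplacian_quotient (ereal (q + 1)) u x =
    ((\<Sum>b\<in>Basis. hessian u x b \<bullet> b) + (q - 1) * (hessian u x (grad u x) \<bullet> grad u x) / (grad u x \<bullet> grad u x))
      / (real DIM('a) + q + 1)"
  using normalized_p_laplacian_expand[OF assms, of "q + 1"]
  by (simp add: p_laplacian_quotient_def laplacian_def divergence_def hessian_def power2_norm_eq_inner add_ac)

text \<open>The rescaled first variation tends to K (c - k) with K > 0. At k = c - \<delta> and k =
  c + \<delta> the limit is strictly positive and strictly negative, so for small \<epsilon> the
  trial values enclose the minimizer.\<close>

lemma eventually_mu_p_between:
  fixes u :: "'a::euclidean_space \<Rightarrow> real"
  assumes S: "open S" "x \<in> S" and u: "C2_on S u" and nz: "grad u x \<noteq> 0" and q: "q \<ge> 0"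
    and \<delta>: "\<delta> > 0"
  shows "\<forall>\<^sub>F \<epsilon> in at_right 0. \<bar>mu_p (ereal (q + 1)) \<epsilon> u x -
    (u x + 1/2 * p_laplacian_quotient (ereal (q + 1)) u x * \<epsilon>\<^sup>2)\<bar> \<le> \<delta> * \<epsilon>\<^sup>2"
proof -
  let ?\<xi> = "grad u x" and ?H = "hessian u x" and ?N = "real DIM('a)"
  define c where "c = 1/2 * p_laplacian_quotient (ereal (q + 1)) u x"
  define K where "K = (LINT z|unit_ball_measure. signed_powr q (?\<xi> \<bullet> z) * (?\<xi> \<bullet> z)) / (?\<xi> \<bullet> ?\<xi>) * (?N + q + 1)"
  define J where "J k \<epsilon> = (LINT z|unit_ball_measure. signed_powr q ((u (x + \<epsilon> *\<^sub>R z) - u x) / \<epsilon> - \<epsilon> * k))" for k \<epsilon>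
  have N: "?N + q + 1 > 0" using q by (simp add: add_nonneg_pos)
  have K: "K > 0"
    using integral_signed_powr_mult_self_pos[OF q nz] nz N by (simp add: K_def)
  have gd: "grad u differentiable (at x)" using u S(2) by (simp add: C2_on_def)
  have lim: "((\<lambda>\<epsilon>. J k \<epsilon> / \<epsilon>) \<longlongrightarrow> K * (c - k)) (at_right 0)" for k
  proof -
    have alg: "P / X * (1/2 * T - k * M) = P / X * M * (1/2 * (T / M) - k)" if "M > 0" for P X T M :: real
    proof -
      have "P / X * M * (1/2 * (T / M) - k) = P / X * (1/2 * (M * (T / M)) - k * M)"
        by (simp only: right_diff_distrib mult_ac)
      moreover have "M * (T / M) = T" using that by simp
      ultimately show ?thesis by (simp only:)
    qed
    show ?thesis
      using tendsto_integral_signed_powr_rescaled[OF S u nz q, of k]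
      unfolding J_def K_def c_def p_laplacian_quotient_ereal[OF gd nz] alg[OF N] .
  qed
  obtain r where r: "r > 0" "cball x r \<subseteq> S" using S open_contains_cball by blast
  have "\<forall>\<^sub>F \<epsilon> in at_right 0. J (c - \<delta>) \<epsilon> / \<epsilon> > 0"
    by (rule order_tendstoD(1)[OF lim]) (use K \<delta> in simp)
  moreover have "\<forall>\<^sub>F \<epsilon> in at_right 0. J (c + \<delta>) \<epsilon> / \<epsilon> < 0"
    by (rule order_tendstoD(2)[OF lim]) (use K \<delta> in \<open>simp add: mult_less_0_iff\<close>)
  moreover have "\<forall>\<^sub>F \<epsilon> in at_right 0. 0 < \<epsilon> \<and> \<epsilon> < r"
    using r(1) by (auto simp: eventually_at_right_field)
  ultimately show ?thesis
  proof eventually_elim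
    case (elim \<epsilon>)
    then have \<epsilon>: "0 < \<epsilon>" "\<epsilon> < r" by auto
    have cu: "continuous_on (cball x \<epsilon>) u"
      by (rule continuous_on_subset[OF C2_on_continuous_on[OF u]]) (use \<epsilon> r(2) in auto)
    \<comment> \<open>Change of variables and homogeneity produce only positive factors, so the sign
      of the first variation can be read off \<open>J\<close>.\<close>
    have \<Phi>: "(LINT y|lebesgue_on (ball x \<epsilon>). signed_powr q (u y - (u x + k * \<epsilon>\<^sup>2))) =
        \<epsilon> ^ DIM('a) * \<epsilon> powr q * J k \<epsilon>" for k
    proof -
      have "(\<lambda>y. signed_powr q (u y - (u x + k * \<epsilon>\<^sup>2)) * 1) \<in> borel_measurable (lebesgue_on (ball x \<epsilon>))"
        by (intro measurable_signed_powr_continuous continuous_intros cu)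
      then have "(LINT y|lebesgue_on (ball x \<epsilon>). signed_powr q (u y - (u x + k * \<epsilon>\<^sup>2))) =
          \<epsilon> ^ DIM('a) * (LINT z|unit_ball_measure. signed_powr q (u (x + \<epsilon> *\<^sub>R z) - (u x + k * \<epsilon>\<^sup>2)))"
        using integral_lebesgue_on_ball_rescale[OF _ \<epsilon>(1)] by simp
      also have "(\<lambda>z. signed_powr q (u (x + \<epsilon> *\<^sub>R z) - (u x + k * \<epsilon>\<^sup>2))) =
          (\<lambda>z. \<epsilon> powr q * signed_powr q ((u (x + \<epsilon> *\<^sub>R z) - u x) / \<epsilon> - \<epsilon> * k))"
      proof
        fix z
        have "u (x + \<epsilon> *\<^sub>R z) - (u x + k * \<epsilon>\<^sup>2) = \<epsilon> * ((u (x + \<epsilon> *\<^sub>R z) - u x) / \<epsilon> - \<epsilon> * k)"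
          using \<epsilon> by (simp add: field_simps power2_eq_square)
        then show "signed_powr q (u (x + \<epsilon> *\<^sub>R z) - (u x + k * \<epsilon>\<^sup>2)) =
          \<epsilon> powr q * signed_powr q ((u (x + \<epsilon> *\<^sub>R z) - u x) / \<epsilon> - \<epsilon> * k)"
          using signed_powr_mult[OF \<epsilon>(1)] by simp
      qed
      finally show ?thesis by (simp add: J_def)
    qed
    have J: "J (c - \<delta>) \<epsilon> > 0" "J (c + \<delta>) \<epsilon> < 0"
      using elim \<epsilon> by (auto simp: zero_less_divide_iff divide_less_0_iff)
    have "u x + (c - \<delta>) * \<epsilon>\<^sup>2 \<le> mu_p (ereal (q + 1)) \<epsilon> u x"
      "mu_p (ereal (q + 1)) \<epsilon> u x \<le> u x + (c + \<delta>) * \<epsilon>\<^sup>2"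
      by (rule mu_p_between[OF cu \<epsilon>(1) q, where ?l1.0="u x + (c - \<delta>) * \<epsilon>\<^sup>2" and ?l2.0="u x + (c + \<delta>) * \<epsilon>\<^sup>2"];
        use J \<epsilon> \<delta> in \<open>auto simp: \<Phi> zero_less_mult_iff mult_less_0_iff intro: mult_right_mono\<close>)+
    then have "\<bar>mu_p (ereal (q + 1)) \<epsilon> u x - (u x + c * \<epsilon>\<^sup>2)\<bar> \<le> \<delta> * \<epsilon>\<^sup>2"
      by (simp add: abs_le_iff algebra_simps)
    then show ?case by (simp only: c_def)
  qed
qed

text \<open>In the mean of maximum and minimum the first-order terms of size \<epsilon> |\<xi>|
  cancel, while the second-order terms agree and survive.\<close>

lemma eventually_mu_p_infinity_between:
  fixes u :: "'a::euclidean_space \<Rightarrow> real"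
  assumes S: "open S" "x \<in> S" and u: "C2_on S u" and nz: "grad u x \<noteq> 0" and \<delta>: "\<delta> > 0"
  shows "\<forall>\<^sub>F \<epsilon> in at_right 0. \<bar>mu_p \<infinity> \<epsilon> u x - (u x + 1/2 * p_laplacian_quotient \<infinity> u x * \<epsilon>\<^sup>2)\<bar> \<le> \<delta> * \<epsilon>\<^sup>2"
proof -
  let ?\<xi> = "grad u x" and ?H = "hessian u x"
  define s where "s = (?H ?\<xi> \<bullet> ?\<xi>) / (norm ?\<xi>)\<^sup>2"
  have lin: "linear ?H" using C2_on_has_derivative_grad[OF u S(2)] has_derivative_linear by blast
  then obtain B where B: "\<And>z. norm (?H z) \<le> B * norm z"
    using bounded_linear.bounded[of ?H] by (auto simp: linear_conv_bounded_linear mult.commute)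
  define K where "K = B\<^sup>2 / (2 * norm ?\<xi>)"
  have K: "K \<ge> 0" by (simp add: K_def)
  obtain r where r: "r > 0" "cball x r \<subseteq> S"
    "\<And>\<epsilon> z. 0 < \<epsilon> \<Longrightarrow> \<epsilon> \<le> r \<Longrightarrow> z \<in> cball 0 1 \<Longrightarrow>
       \<bar>u (x + \<epsilon> *\<^sub>R z) - u x - \<epsilon> * (?\<xi> \<bullet> z) - \<epsilon>\<^sup>2 * (1/2 * (?H z \<bullet> z))\<bar> \<le> \<delta> / 2 * \<epsilon>\<^sup>2"
    using second_order_expansion[OF S u, of "\<delta> / 2"] \<delta> by (metis half_gt_zero)
  \<comment> \<open>Chosen so that the cubic error consumes at most the other half of \<delta>; K +
    1 keeps the denominator positive when K = 0.\<close>
  define r' where "r' = min r (\<delta> / (2 * (K + 1)))"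
  have r': "r' > 0" using r \<delta> K by (simp add: r'_def)
  have "\<forall>\<^sub>F \<epsilon> in at_right 0. 0 < \<epsilon> \<and> \<epsilon> < r'"
    using r' by (auto simp: eventually_at_right_field)
  then show ?thesis
  proof eventually_elim
    case (elim \<epsilon>)
    then have \<epsilon>: "0 < \<epsilon>" "\<epsilon> \<le> r" "\<epsilon> \<le> \<delta> / (2 * (K + 1))" by (auto simp: r'_def)
    have cu: "continuous_on (cball x \<epsilon>) u"
      by (rule continuous_on_subset[OF C2_on_continuous_on[OF u]]) (use \<epsilon> r(2) in auto)
    obtain y1 where y1: "y1 \<in> cball x \<epsilon>" "\<And>y. y \<in> cball x \<epsilon> \<Longrightarrow> u y \<le> u y1"
      using continuous_attains_sup[OF _ _ cu] \<epsilon> by auto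
    obtain y2 where y2: "y2 \<in> cball x \<epsilon>" "\<And>y. y \<in> cball x \<epsilon> \<Longrightarrow> u y2 \<le> u y"
      using continuous_attains_inf[OF _ _ cu] \<epsilon> by auto
    have max: "\<bar>u y1 - (u x + \<epsilon> * norm ?\<xi> + \<epsilon>\<^sup>2 * (1/2 * s))\<bar> \<le> \<delta> / 2 * \<epsilon>\<^sup>2 + \<epsilon> ^ 3 * K"
      unfolding s_def K_def
      by (rule maximum_on_ball_expansion[OF nz lin B \<epsilon>(1) r(3)[OF \<epsilon>(1,2)] y1(2,1) refl])
    \<comment> \<open>The minimum is the maximum of -u, whose gradient and Hessian are -\<xi> and
      -H; the normalized quadratic form becomes -s.\<close>
    have min: "\<bar>(- u y2) - (- u x + \<epsilon> * norm (- ?\<xi>) +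
        \<epsilon>\<^sup>2 * (1/2 * ((- ?H (- ?\<xi>) \<bullet> - ?\<xi>) / (norm (- ?\<xi>))\<^sup>2)))\<bar> \<le>
        \<delta> / 2 * \<epsilon>\<^sup>2 + \<epsilon> ^ 3 * (B\<^sup>2 / (2 * norm (- ?\<xi>)))"
    proof (rule maximum_on_ball_expansion[where u="\<lambda>y. - u y" and H="\<lambda>z. - ?H z"])
      show "linear (\<lambda>z. - ?H z)" using lin by (rule linear_compose_neg)
      show "\<bar>- u (x + \<epsilon> *\<^sub>R z) - - u x - \<epsilon> * (- ?\<xi> \<bullet> z) - \<epsilon>\<^sup>2 * (1/2 * (- ?H z \<bullet> z))\<bar> \<le> \<delta> / 2 * \<epsilon>\<^sup>2"
        if "z \<in> cball 0 1" for z
      proof -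
        have "- u (x + \<epsilon> *\<^sub>R z) - - u x - \<epsilon> * (- ?\<xi> \<bullet> z) - \<epsilon>\<^sup>2 * (1/2 * (- ?H z \<bullet> z)) =
          - (u (x + \<epsilon> *\<^sub>R z) - u x - \<epsilon> * (?\<xi> \<bullet> z) - \<epsilon>\<^sup>2 * (1/2 * (?H z \<bullet> z)))" by simp
        then show ?thesis using r(3)[OF \<epsilon>(1,2) that] by (simp only: abs_minus_cancel)
      qed
    qed (use nz B \<epsilon> y2 in auto)
    have "\<epsilon> ^ 3 * K \<le> \<delta> / 2 * \<epsilon>\<^sup>2"
    proof -
      have "\<epsilon> * K \<le> \<epsilon> * (K + 1)" using \<epsilon> by (intro mult_left_mono) auto
      also have "\<dots> \<le> \<delta> / 2" using \<epsilon>(3) K by (simp add: pos_le_divide_eq mult_ac)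
      finally have "\<epsilon> * K * \<epsilon>\<^sup>2 \<le> \<delta> / 2 * \<epsilon>\<^sup>2" by (intro mult_right_mono) auto
      then show ?thesis by (simp add: power3_eq_cube power2_eq_square mult_ac)
    qed
    moreover have "mu_p \<infinity> \<epsilon> u x = (u y2 + u y1) / 2"
      by (rule mu_p_infinity[OF cu \<epsilon>(1) y1(2,1) refl y2(2,1) refl])
    moreover have "p_laplacian_quotient \<infinity> u x = s"
      by (simp add: p_laplacian_quotient_def normalized_p_laplacian_def s_def)
    moreover have "(- ?H (- ?\<xi>) \<bullet> - ?\<xi>) / (norm (- ?\<xi>))\<^sup>2 = - s"
      by (simp add: s_def linear_neg[OF lin])
    ultimately show ?case
      using max min unfolding K_def abs_le_iff by (simp add: field_simps)
  qed
qed

theorem theorem3p2: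
  fixes p :: ereal and \<Omega> :: "'a::euclidean_space set" and x :: 'a and u :: "'a \<Rightarrow> real"
  assumes "1 \<le> p"
    and "open \<Omega>" and "x \<in> \<Omega>"
    and "C2_on \<Omega> u" and "grad u x \<noteq> 0"
  shows "(\<lambda>\<epsilon>. mu_p p \<epsilon> u x - (u x + 1/2 * p_laplacian_quotient p u x * \<epsilon>\<^sup>2))
           \<in> o[at_right 0](\<lambda>\<epsilon>. \<epsilon>\<^sup>2)"
proof (rule landau_o.smallI)
  fix \<delta> :: real assume \<delta>: "\<delta> > 0"
  show "\<forall>\<^sub>F \<epsilon> in at_right 0. norm (mu_p p \<epsilon> u x - (u x + 1/2 * p_laplacian_quotient p u x * \<epsilon>\<^sup>2)) \<le> \<delta> * norm (\<epsilon>\<^sup>2)"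
  proof (cases p)
    case (real r)
    then have "r - 1 \<ge> 0" using assms(1) by simp
    from eventually_mu_p_between[OF assms(2-5) this \<delta>] show ?thesis
      by (simp add: real)
  next
    case PInf
    then show ?thesis using eventually_mu_p_infinity_between[OF assms(2-5) \<delta>] by simp
  next
    case MInf
    then show ?thesis using assms(1) by simp
  qed
qed

end
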